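(* Let $(G_n)$ be a sequence of graphs where $G_n$ is an $(n,d,\lambda)$-graph with $d=d(n)$, $\lambda=\lambda(n)$ satisfying $d^2/n \gg \lambda$, i.e. $d^2/(n\lambda)\to\infty$. Then for every fixed $\epsilon>0$ and all sufficiently large $n$, $G=G_n$ satisfies: (i) for every subgraph $H\subseteq G$ with $\Delta(H)\le (1/2-\epsilon)d$, the graph $G-H$ is pancyclic; (ii) there is a subgraph $H\subseteq G$ with $\Delta(H)\le (1/2+\epsilon)d$ such that $G-H$ is not pancyclic. (That is, $G$ has local resilience $(1/2+o(1))d$ with respect to being pancyclic.)
   Context: An $(n,d,\lambda)$-graph is a $d$-regular graph on $n$ vertices such that every eigenvalue of its adjacency matrix other than the largest one (which is $d$) has absolute value at most $\lambda$. A graph on $n$ vertices is pancyclic if it contains a cycle of length $t$ for every $3\le t\le n$. $G-H$ denotes $G$ with the edges of $H$ deleted. The local resilience of a graph with respect to a monotone increasing property is the minimum $r$ such that deleting at most $r$ edges at each vertex yields a graph without the property. *)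

theory Defs
  imports "Jordan_Normal_Form.Char_Poly"
begin

record 'a ugraph =
  verts :: "'a set"
  edges :: "'a set set"

definition simple_graph :: "'a ugraph \<Rightarrow> bool" where
  "simple_graph G \<longleftrightarrow> finite (verts G) \<and> (\<forall>e\<in>edges G. e \<subseteq> verts G \<and> card e = 2)"

definition subgraph :: "'a ugraph \<Rightarrow> 'a ugraph \<Rightarrow> bool" where
  "subgraph H G \<longleftrightarrow> simple_graph H \<and> verts H \<subseteq> verts G \<and> edges H \<subseteq> edges G"

definition delete_edges :: "'a ugraph \<Rightarrow> 'a ugraph \<Rightarrow> 'a ugraph" where
  "delete_edges G H = \<lparr>verts = verts G, edges = edges G - edges H\<rparr>"

definition vdegree :: "'a ugraph \<Rightarrow> 'a \<Rightarrow> nat" where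
  "vdegree G v = card {e \<in> edges G. v \<in> e}"

(* Sup rather than Max, so that the graph without vertices has maximum degree 0. *)
definition max_degree :: "'a ugraph \<Rightarrow> nat" where
  "max_degree G = (SUP v\<in>verts G. vdegree G v)"

definition regular :: "nat \<Rightarrow> 'a ugraph \<Rightarrow> bool" where
  "regular d G \<longleftrightarrow> (\<forall>v\<in>verts G. vdegree G v = d)"

definition is_cycle :: "'a ugraph \<Rightarrow> 'a list \<Rightarrow> bool" where
  "is_cycle G vs \<longleftrightarrow> length vs \<ge> 3 \<and> distinct vs \<and> set vs \<subseteq> verts G \<and>
     (\<forall>i<length vs. {vs ! i, vs ! ((i + 1) mod length vs)} \<in> edges G)"

definition pancyclic :: "'a ugraph \<Rightarrow> bool" where
  "pancyclic G \<longleftrightarrow>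
     (\<forall>t. 3 \<le> t \<and> t \<le> card (verts G) \<longrightarrow> (\<exists>vs. is_cycle G vs \<and> length vs = t))"

definition adjacency_matrix :: "'a ugraph \<Rightarrow> 'a list \<Rightarrow> real mat" where
  "adjacency_matrix G vs =
     mat (length vs) (length vs) (\<lambda>(i, j). if {vs ! i, vs ! j} \<in> edges G then 1 else 0)"

(* Eigenvalues are counted with multiplicity (a real symmetric matrix has all roots of its
   characteristic polynomial real), and a single copy of the largest one, d, is removed: if d
   is a multiple eigenvalue, i.e. if G is disconnected, then the condition forces d \<le> lam.
   The multiset of eigenvalues does not depend on the enumeration vs of the vertices. *)
definition ndl_graph :: "nat \<Rightarrow> nat \<Rightarrow> real \<Rightarrow> 'a ugraph \<Rightarrow> bool" where
  "ndl_graph n d lam G \<longleftrightarrow>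
     simple_graph G \<and> card (verts G) = n \<and> regular d G \<and>
     (\<exists>vs. distinct vs \<and> set vs = verts G \<and>
        (\<forall>\<mu> \<in># proots (char_poly (adjacency_matrix G vs)) - {#real d#}. \<bar>\<mu>\<bar> \<le> lam))"

end

(* Part (i).  A trace argument turns the eigenvalue condition into the expander mixing lemma: with
   B = A - (d/n) J one has tr(B^(2m)) = sum of mu^(2m) over the non-principal eigenvalues, which is at
   most n lam^(2m), and iterating Cauchy-Schwarz along m = 2^k removes the factor n.  After the
   deletion every vertex keeps at least (1/2 + eps) d neighbours, so mixing makes the neighbourhood of
   every set of size proportional to d larger than half of the vertex set.

   Such a graph is Hamiltonian: on a longest path rotate once at each end, with pivots confined to
   two short blocks of the path.  The outcome of a further rotation is then determined by its pivot
   alone, independently of the first two, so more than half of the vertices arise as second ends,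
   simultaneously for all first ends; the neighbours of the first ends meet them.

   A random set Z of vertices (chosen by an exponential moment argument) contains only a few
   neighbours of any vertex in G but a positive proportion of them in the remaining graph.  Hence
   deleting any R in Z leaves a Hamiltonian graph, which yields all long cycles.  For the short ones take a
   Hamilton cycle on W = V - Z with its shift sigma by t - 3 and look for v, x in Z, y in W with
   v ~ x ~ y and sigma(y) ~ v.  Fixing v and summing, mixing gives about (d/n) z(v) w(v) such triples
   when xy may be any edge of G, and fixing x at most (d/n) z(x) h(x) of them have xy deleted, where
   z, w are remaining degrees into Z, W and h is the deleted degree into W.  As w > h, one survives.

   Part (ii).  A maximum cut leaves each vertex at most d/2 neighbours on its own side; deleting the
   edges inside the two sides makes the graph bipartite, hence triangle-free. *)

theory Submission
  imports Defs "HOL-Analysis.Convex" "Jordan_Normal_Form.Schur_Decomposition"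
begin

section \<open>Spectral bound for regular symmetric matrices\<close>

text \<open>A constant factor is negligible against the exponents \<open>2 ^ k\<close>: if the ratio
  \<open>r / l\<close> were above 1, its powers would outgrow \<open>c\<close>.\<close>

lemma le_of_powers_le:
  fixes r l c :: real
  assumes "0 \<le> r" "0 \<le> l" and pow: "\<And>k. r ^ 2 ^ k \<le> c * l ^ 2 ^ k"
  shows "r \<le> l"
proof (rule ccontr)
  assume "\<not> r \<le> l"
  then have rl: "l < r" "0 < r" using assms by auto
  show False
  proof (cases "l = 0")
    case True
    then show ?thesis using pow[of 0] rl by simp
  next
    case False
    then have l: "0 < l" using assms by simp
    define q where "q = r / l"
    have q: "1 < q" using rl l by (simp add: q_def)
    obtain N where N: "c < q ^ N" using real_arch_pow[OF q] by blast
    have "q ^ N \<le> q ^ 2 ^ N" by (rule power_increasing) (use q in \<open>auto intro: less_imp_le less_exp\<close>)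
    also have "\<dots> = r ^ 2 ^ N / l ^ 2 ^ N" by (simp add: q_def power_divide)
    also have "\<dots> \<le> c" using pow[of N] l by (simp add: pos_divide_le_eq)
    finally show False using N by simp
  qed
qed

text \<open>The numbers \<open>b m i j\<close> stand for the entries of the m-th power of a
  symmetric matrix. With \<open>N m\<close> the squared norm of that power applied to
  \<open>y\<close>, Cauchy-Schwarz gives \<open>(N m)\<^sup>2 \<le> S * N (2 * m)\<close>. Iterating
  this from \<open>m = 1\<close> and inserting the trace bound at \<open>m = 2 ^ k\<close> leaves
  the factor \<open>c\<close> outside a growing power, where it disappears.\<close>

lemma bilinear_form_bound_from_traces:
  fixes b :: "nat \<Rightarrow> 'i \<Rightarrow> 'i \<Rightarrow> real"
  assumes sym: "\<And>m i j. i \<in> I \<Longrightarrow> j \<in> I \<Longrightarrow> b m i j = b m j i"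
    and mult: "\<And>m l i j. m \<ge> 1 \<Longrightarrow> l \<ge> 1 \<Longrightarrow> i \<in> I \<Longrightarrow> j \<in> I \<Longrightarrow>
      b (m + l) i j = (\<Sum>k\<in>I. b m i k * b l k j)"
    and trace: "\<And>m. m \<ge> 1 \<Longrightarrow> (\<Sum>i\<in>I. b (2 * m) i i) \<le> c * (\<mu>\<^sup>2) ^ m"
    and fin: "finite I"
  shows "(\<Sum>i\<in>I. \<Sum>j\<in>I. x i * b 1 i j * y j)\<^sup>2 \<le> \<mu>\<^sup>2 * (\<Sum>i\<in>I. (x i)\<^sup>2) * (\<Sum>i\<in>I. (y i)\<^sup>2)"
proof -
  define S where "S = (\<Sum>i\<in>I. (y i)\<^sup>2)"
  define z where "z m k = (\<Sum>j\<in>I. b m k j * y j)" for m k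
  define N where "N m = (\<Sum>k\<in>I. (z m k)\<^sup>2)" for m
  have S0: "S \<ge> 0" by (simp add: S_def sum_nonneg)
  have N0: "N m \<ge> 0" for m by (simp add: N_def sum_nonneg)
  \<comment> \<open>By symmetry one of the two factors moves to the other side of the scalar
    product: the squared norm of \<open>z m\<close> is the product of \<open>y\<close> with
    \<open>z (2 * m)\<close>.\<close>
  have N_double: "N m = (\<Sum>i\<in>I. y i * z (2 * m) i)" if m: "m \<ge> 1" for m
  proof -
    have "(\<Sum>i\<in>I. y i * z (2 * m) i) = (\<Sum>i\<in>I. \<Sum>j\<in>I. \<Sum>k\<in>I. y i * (b m i k * b m k j) * y j)"
      unfolding z_def sum_distrib_left
      by (intro sum.cong refl)
        (simp add: mult[OF m m, folded mult_2] sum_distrib_left sum_distrib_right mult.assoc)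
    also have "\<dots> = (\<Sum>i\<in>I. \<Sum>k\<in>I. \<Sum>j\<in>I. y i * (b m i k * b m k j) * y j)"
      by (intro sum.cong refl sum.swap)
    also have "\<dots> = (\<Sum>k\<in>I. \<Sum>i\<in>I. \<Sum>j\<in>I. y i * (b m i k * b m k j) * y j)"
      by (rule sum.swap)
    also have "\<dots> = (\<Sum>k\<in>I. \<Sum>i\<in>I. \<Sum>j\<in>I. (b m k i * y i) * (b m k j * y j))"
      by (intro sum.cong refl) (simp add: sym[of _ _ m] mult_ac)
    also have "\<dots> = N m" by (simp add: N_def z_def power2_eq_square sum_product)
    finally show ?thesis by simp
  qed
  have N_square: "(N m)\<^sup>2 \<le> S * N (2 * m)" if "m \<ge> 1" for m
    unfolding N_double[OF that] unfolding N_def S_def by (rule Cauchy_Schwarz_ineq_sum)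
  \<comment> \<open>Cauchy-Schwarz in each row bounds \<open>N m\<close> by \<open>S\<close> times
    the sum of all squared entries, which for a symmetric matrix is the trace of its square.\<close>
  have N_trace: "N m \<le> S * (c * (\<mu>\<^sup>2) ^ m)" if m: "m \<ge> 1" for m
  proof -
    have "N m \<le> (\<Sum>k\<in>I. (\<Sum>j\<in>I. (b m k j)\<^sup>2) * S)"
      unfolding N_def z_def S_def by (intro sum_mono Cauchy_Schwarz_ineq_sum)
    also have "\<dots> = S * (\<Sum>k\<in>I. \<Sum>j\<in>I. b m k j * b m j k)"
      by (simp add: sum_distrib_left mult.commute power2_eq_square sym[of _ _ m] cong: sum.cong)
    also have "\<dots> = S * (\<Sum>k\<in>I. b (2 * m) k k)"
      by (simp add: mult[OF m m, folded mult_2] cong: sum.cong)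
    also have "\<dots> \<le> S * (c * (\<mu>\<^sup>2) ^ m)"
      by (rule mult_left_mono[OF trace[OF m] S0])
    finally show ?thesis .
  qed
  have N1: "N 1 \<le> \<mu>\<^sup>2 * S"
  proof (cases "S = 0")
    case True
    then show ?thesis using N_trace[of 1] by simp
  next
    case False
    then have S: "S > 0" using S0 by simp
    have "(N 1 / S) ^ 2 ^ k \<le> N (2 ^ k) / S" for k
    proof (induction k)
      case (Suc k)
      have "(N 1 / S) ^ 2 ^ Suc k = ((N 1 / S) ^ 2 ^ k)\<^sup>2"
        by (simp add: power_mult[symmetric] mult.commute)
      also have "\<dots> \<le> (N (2 ^ k) / S)\<^sup>2"
        by (rule power_mono[OF Suc]) (use N0 S0 in simp)
      also have "\<dots> \<le> N (2 ^ Suc k) / S"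
        using N_square[of "2 ^ k"] S by (simp add: field_simps power2_eq_square)
      finally show ?case .
    qed simp
    also have "N (2 ^ k) / S \<le> c * (\<mu>\<^sup>2) ^ 2 ^ k" for k
      using N_trace[of "2 ^ k"] S by (simp add: pos_divide_le_eq mult.commute)
    finally have pow: "(N 1 / S) ^ 2 ^ k \<le> c * (\<mu>\<^sup>2) ^ 2 ^ k" for k .
    have "N 1 / S \<le> \<mu>\<^sup>2"
      by (rule le_of_powers_le[OF _ _ pow]) (use N0[of 1] S0 in simp_all)
    then show ?thesis using S by (simp add: pos_divide_le_eq)
  qed
  have "(\<Sum>i\<in>I. \<Sum>j\<in>I. x i * b 1 i j * y j) = (\<Sum>i\<in>I. x i * z 1 i)"
    by (simp add: z_def sum_distrib_left mult.assoc)
  then have "(\<Sum>i\<in>I. \<Sum>j\<in>I. x i * b 1 i j * y j)\<^sup>2 \<le> (\<Sum>i\<in>I. (x i)\<^sup>2) * N 1"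
    unfolding N_def by (simp only: Cauchy_Schwarz_ineq_sum)
  also have "\<dots> \<le> (\<Sum>i\<in>I. (x i)\<^sup>2) * (\<mu>\<^sup>2 * S)"
    by (rule mult_left_mono[OF N1]) (simp add: sum_nonneg)
  finally show ?thesis by (simp add: S_def mult_ac)
qed

section \<open>Real spectrum of a symmetric real matrix\<close>

text \<open>The Hermitian form \<open>q\<close> at an eigenvector \<open>v\<close> equals
  \<open>z\<close> times the squared norm of \<open>v\<close>, and symmetry of \<open>A\<close>
  makes \<open>q\<close> its own conjugate.\<close>

lemma real_symmetric_eigenvalue_real:
  assumes A: "(A :: real mat) \<in> carrier_mat n n"
    and sym: "\<And>i j. i < n \<Longrightarrow> j < n \<Longrightarrow> A $$ (i, j) = A $$ (j, i)"
    and ev: "eigenvalue (map_mat complex_of_real A) z"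
  shows "z \<in> \<real>"
proof -
  let ?C = "map_mat complex_of_real A"
  obtain v where v: "v \<in> carrier_vec n" "v \<noteq> 0\<^sub>v n" "?C *\<^sub>v v = z \<cdot>\<^sub>v v"
    using ev A unfolding eigenvalue_def eigenvector_def by auto
  define N where "N = (\<Sum>i<n. (cmod (v $ i))\<^sup>2)"
  define q where "q = (\<Sum>i<n. \<Sum>j<n. cnj (v $ i) * (complex_of_real (A $$ (i, j)) * v $ j))"
  have row: "(\<Sum>j<n. complex_of_real (A $$ (i, j)) * v $ j) = z * v $ i" if i: "i < n" for i
  proof -
    have "(?C *\<^sub>v v) $ i = (z \<cdot>\<^sub>v v) $ i" using v by simp
    then show ?thesis using i A v(1) by (simp add: scalar_prod_def lessThan_atLeast0)
  qed
  have "q = (\<Sum>i<n. cnj (v $ i) * (z * v $ i))"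
    unfolding q_def by (intro sum.cong refl) (simp add: sum_distrib_left[symmetric] row)
  also have "\<dots> = z * complex_of_real N"
    unfolding N_def of_real_sum sum_distrib_left
    by (intro sum.cong refl) (simp add: complex_norm_square mult_ac del: of_real_power)
  finally have q: "q = z * complex_of_real N" .
  have "cnj q = (\<Sum>i<n. \<Sum>j<n. v $ i * (complex_of_real (A $$ (i, j)) * cnj (v $ j)))"
    by (simp add: q_def)
  also have "\<dots> = (\<Sum>j<n. \<Sum>i<n. v $ i * (complex_of_real (A $$ (i, j)) * cnj (v $ j)))"
    by (rule sum.swap)
  also have "\<dots> = q"
    unfolding q_def by (intro sum.cong refl) (simp add: sym mult_ac)
  finally have "cnj q = q" .
  moreover have "N \<noteq> 0"
  proof
    assume "N = 0"
    then have "\<forall>i<n. v $ i = 0" by (auto simp: N_def sum_nonneg_eq_0_iff)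
    then have "v = 0\<^sub>v n" using v(1) by (intro eq_vecI) auto
    then show False using v(2) by simp
  qed
  ultimately have "cnj z = z" using q by simp
  then show ?thesis by (simp add: Reals_cnj_iff)
qed

text \<open>The characteristic polynomial factors over the complex numbers and all its roots are
  real. The embedding of real polynomials is injective, so the factorization descends.\<close>

lemma real_symmetric_char_poly_splits:
  assumes A: "(A :: real mat) \<in> carrier_mat n n"
    and sym: "\<And>i j. i < n \<Longrightarrow> j < n \<Longrightarrow> A $$ (i, j) = A $$ (j, i)"
  obtains es where "char_poly A = (\<Prod>e\<leftarrow>es. [:- e, 1:])" "length es = n"
proof -
  let ?C = "map_mat complex_of_real A"
  interpret cr: map_poly_inj_comm_ring_hom complex_of_real ..
  have C: "?C \<in> carrier_mat n n" using A by simp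
  obtain as where as: "char_poly ?C = (\<Prod>a\<leftarrow>as. [:- a, 1:])" "length as = n"
    using char_poly_factorized[OF C] by blast
  have real: "complex_of_real (Re a) = a" if "a \<in> set as" for a
  proof -
    have "poly (char_poly ?C) a = 0"
      unfolding as poly_prod_list using that by (auto simp: prod_list_zero_iff)
    then have "eigenvalue ?C a" using eigenvalue_root_char_poly[OF C] by simp
    then have "a \<in> \<real>" by (intro real_symmetric_eigenvalue_real[OF A] sym)
    then show ?thesis by (rule of_real_Re)
  qed
  have "map_poly complex_of_real (char_poly A) = char_poly ?C"
    by (rule of_real_hom.char_poly_hom[OF A, symmetric])
  also have "\<dots> = (\<Prod>a\<leftarrow>as. map_poly complex_of_real [:- Re a, 1:])"
    unfolding as using real by (intro arg_cong[where f = prod_list] map_cong refl) (simp add: hom_distribs)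
  also have "\<dots> = map_poly complex_of_real (\<Prod>e\<leftarrow>map Re as. [:- e, 1:])"
    by (simp add: cr.hom_prod_list comp_def)
  finally have "char_poly A = (\<Prod>e\<leftarrow>map Re as. [:- e, 1:])" by simp
  then show thesis by (rule that) (simp add: as(2))
qed

section \<open>Traces, entries and row sums of matrix powers\<close>

definition mat_trace :: "'a::comm_monoid_add mat \<Rightarrow> 'a" where
  "mat_trace A = (\<Sum>i<dim_row A. A $$ (i, i))"

lemma mat_mult_entry:
  assumes "A \<in> carrier_mat n n" "B \<in> carrier_mat n n" "i < n" "j < n"
  shows "(A * B) $$ (i, j) = (\<Sum>k<n. A $$ (i, k) * B $$ (k, j))"
  using assms by (simp add: scalar_prod_def lessThan_atLeast0)

lemma mat_trace_commute:
  fixes A B :: "'a::comm_semiring_0 mat"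
  assumes A: "A \<in> carrier_mat n n" and B: "B \<in> carrier_mat n n"
  shows "mat_trace (A * B) = mat_trace (B * A)"
proof -
  have "mat_trace (A * B) = (\<Sum>i<n. \<Sum>k<n. A $$ (i, k) * B $$ (k, i))"
    unfolding mat_trace_def using A B by (intro sum.cong) (auto simp: mat_mult_entry[OF A B] simp del: index_mult_mat(1))
  also have "\<dots> = (\<Sum>k<n. \<Sum>i<n. B $$ (k, i) * A $$ (i, k))"
    by (subst sum.swap) (simp add: mult.commute)
  also have "\<dots> = mat_trace (B * A)"
    unfolding mat_trace_def using A B by (intro sum.cong) (auto simp: mat_mult_entry[OF B A] simp del: index_mult_mat(1))
  finally show ?thesis .
qed

lemma upper_triangular_pow:
  fixes B :: "'a::comm_semiring_1 mat"
  assumes B: "B \<in> carrier_mat n n" and ut: "upper_triangular B"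
  shows "upper_triangular (B ^\<^sub>m m) \<and> (\<forall>i<n. (B ^\<^sub>m m) $$ (i, i) = (B $$ (i, i)) ^ m)"
proof (induction m)
  case (Suc m)
  have Bm: "B ^\<^sub>m m \<in> carrier_mat n n" using B by simp
  have *: "(B ^\<^sub>m Suc m) $$ (i, j) = (\<Sum>k<n. (B ^\<^sub>m m) $$ (i, k) * B $$ (k, j))"
    if "i < n" "j < n" for i j using mat_mult_entry[OF Bm B that] by simp
  have zero: "(B ^\<^sub>m m) $$ (i, k) = 0" if "k < i" "i < n" for i k
    using upper_triangularD[of "B ^\<^sub>m m" k i] Suc that B by simp
  have zero': "B $$ (k, j) = 0" if "j < k" "k < n" for j k
    using upper_triangularD[OF ut] that B by auto
  have prod0: "(B ^\<^sub>m m) $$ (i, k) * B $$ (k, j) = 0" if "j < i \<or> k \<noteq> i \<and> j = i" "i < n" "k < n" for i j k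
  proof (cases "k < i")
    case True
    then show ?thesis using zero that by simp
  next
    case False
    then have "j < k" using that by auto
    then show ?thesis using zero' that by simp
  qed
  have "upper_triangular (B ^\<^sub>m Suc m)"
  proof (rule upper_triangularI)
    fix j i assume ji: "j < i" "i < dim_row (B ^\<^sub>m Suc m)"
    then have "i < n" using B by (simp split: if_splits)
    then show "(B ^\<^sub>m Suc m) $$ (i, j) = 0"
      using ji by (subst *) (auto intro!: sum.neutral prod0)
  qed
  moreover have "(B ^\<^sub>m Suc m) $$ (i, i) = (B $$ (i, i)) ^ Suc m" if i: "i < n" for i
  proof -
    have "(B ^\<^sub>m Suc m) $$ (i, i) = (\<Sum>k\<in>{i}. (B ^\<^sub>m m) $$ (i, k) * B $$ (k, i))"
      unfolding *[OF i i] by (rule sum.mono_neutral_right) (use i prod0 in auto)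
    then show ?thesis using Suc i by (simp add: mult.commute)
  qed
  ultimately show ?case by blast
qed (use B in auto)

text \<open>Schur decomposition makes \<open>A\<close> similar to an upper triangular matrix with
  diagonal \<open>es\<close>. Powers of that matrix have the powers of \<open>es\<close> on the
  diagonal, and the trace is invariant under similarity.\<close>

lemma mat_trace_pow:
  fixes A :: "real mat"
  assumes A: "A \<in> carrier_mat n n" and cp: "char_poly A = (\<Prod>e\<leftarrow>es. [:- e, 1:])"
  shows "mat_trace (A ^\<^sub>m m) = (\<Sum>e\<leftarrow>es. e ^ m)"
proof -
  obtain B P Q where schur: "schur_decomposition A es = (B, P, Q)"
    by (cases "schur_decomposition A es") auto
  have sim: "similar_mat_wit A B P Q" and ut: "upper_triangular B" and diag: "diag_mat B = es"
    using schur_decomposition[OF A cp schur] by auto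
  have w: "B \<in> carrier_mat n n" "P \<in> carrier_mat n n" "Q \<in> carrier_mat n n" "Q * P = 1\<^sub>m n"
    using similar_mat_witD2[OF A sim] by blast+
  have Bm: "B ^\<^sub>m m \<in> carrier_mat n n" using w(1) by simp
  have "A ^\<^sub>m m = P * (B ^\<^sub>m m * Q)"
    unfolding similar_mat_wit_pow_id[OF sim] by (rule assoc_mult_mat[OF w(2) Bm w(3)])
  then have "mat_trace (A ^\<^sub>m m) = mat_trace (B ^\<^sub>m m * Q * P)"
    using mat_trace_commute[OF w(2), of "B ^\<^sub>m m * Q"] w(3) Bm by simp
  also have "B ^\<^sub>m m * Q * P = B ^\<^sub>m m"
    unfolding assoc_mult_mat[OF Bm w(3,2)] w(4) by (rule right_mult_one_mat[OF Bm])
  also have "mat_trace (B ^\<^sub>m m) = (\<Sum>i<n. (B $$ (i, i)) ^ m)"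
    unfolding mat_trace_def using upper_triangular_pow[OF w(1) ut] Bm by (intro sum.cong) auto
  also have "\<dots> = (\<Sum>e\<leftarrow>diag_mat B. e ^ m)"
    using w(1) by (simp add: diag_mat_def comp_def interv_sum_list_conv_sum_set_nat lessThan_atLeast0)
  finally show ?thesis unfolding diag .
qed

lemma pow_mat_add:
  fixes A :: "'a::semiring_1 mat"
  assumes A: "A \<in> carrier_mat n n"
  shows "A ^\<^sub>m (m + l) = A ^\<^sub>m m * A ^\<^sub>m l"
proof (induction l)
  case (Suc l)
  have "A ^\<^sub>m (m + Suc l) = (A ^\<^sub>m m * A ^\<^sub>m l) * A" using Suc by simp
  also have "\<dots> = A ^\<^sub>m m * (A ^\<^sub>m l * A)"
    by (rule assoc_mult_mat[of _ n n _ n _ n]) (use A in auto)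
  finally show ?case by simp
qed (use A in auto)

lemma symmetric_pow_mat:
  fixes A :: "'a::comm_semiring_1 mat"
  assumes A: "A \<in> carrier_mat n n"
    and sym: "\<And>i j. i < n \<Longrightarrow> j < n \<Longrightarrow> A $$ (i, j) = A $$ (j, i)"
    and ij: "i < n" "j < n"
  shows "(A ^\<^sub>m m) $$ (i, j) = (A ^\<^sub>m m) $$ (j, i)"
  using ij
proof (induction m arbitrary: i j)
  case (Suc m)
  have Am: "A ^\<^sub>m m \<in> carrier_mat n n" using A by simp
  have "(A ^\<^sub>m Suc m) $$ (i, j) = (\<Sum>k<n. (A ^\<^sub>m m) $$ (i, k) * A $$ (k, j))"
    using mat_mult_entry[OF Am A Suc.prems] by simp
  also have "\<dots> = (\<Sum>k<n. A $$ (j, k) * (A ^\<^sub>m m) $$ (k, i))"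
    by (intro sum.cong refl) (use Suc sym in \<open>simp add: mult.commute\<close>)
  also have "\<dots> = (A ^\<^sub>m (1 + m)) $$ (j, i)"
    unfolding pow_mat_add[OF A] using mat_mult_entry[OF A Am Suc.prems(2,1)] A by simp
  finally show ?case by simp
qed (use A in \<open>auto simp: one_mat_def\<close>)

lemma row_sum_pow_mat:
  fixes A :: "'a::comm_semiring_1 mat"
  assumes A: "A \<in> carrier_mat n n"
    and row: "\<And>i. i < n \<Longrightarrow> (\<Sum>j<n. A $$ (i, j)) = d" and i: "i < n"
  shows "(\<Sum>j<n. (A ^\<^sub>m m) $$ (i, j)) = d ^ m"
proof (induction m)
  case 0
  have "(\<Sum>j<n. (A ^\<^sub>m 0) $$ (i, j)) = (\<Sum>j<n. if j = i then 1 else 0)"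
    by (intro sum.cong refl) (use A i in auto)
  then show ?case using i by simp
next
  case (Suc m)
  have Am: "A ^\<^sub>m m \<in> carrier_mat n n" using A by simp
  have "(\<Sum>j<n. (A ^\<^sub>m Suc m) $$ (i, j)) = (\<Sum>j<n. \<Sum>k<n. (A ^\<^sub>m m) $$ (i, k) * A $$ (k, j))"
    using mat_mult_entry[OF Am A i] by simp
  also have "\<dots> = (\<Sum>k<n. (A ^\<^sub>m m) $$ (i, k) * (\<Sum>j<n. A $$ (k, j)))"
    by (subst sum.swap) (simp add: sum_distrib_left)
  also have "\<dots> = d ^ m * d" by (simp add: row Suc sum_distrib_right[symmetric])
  finally show ?case by (simp add: mult.commute)
qed

lemma proots_linear_factors: "proots (\<Prod>e\<leftarrow>es. [:- e, 1:]) = mset (es :: 'a::idom list)"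
proof (induction es)
  case (Cons e es)
  have "(\<Prod>e\<leftarrow>es. [:- e, 1:]) \<noteq> 0" by (auto simp: prod_list_zero_iff)
  then have "proots ([:- e, 1:] * (\<Prod>e\<leftarrow>es. [:- e, 1:]))
      = proots [:- e, 1:] + proots (\<Prod>e\<leftarrow>es. [:- e, 1:])"
    by (intro proots_mult) auto
  then show ?case using Cons by simp
qed simp

text \<open>Subtracting \<open>d / n\<close> from every entry removes the eigenvalue belonging to
  the all-ones vector. The powers of the difference are known explicitly, namely \<open>b m\<close>,
  so their traces are sums over the remaining eigenvalues and
  \<open>bilinear_form_bound_from_traces\<close> applies.\<close>

lemma regular_symmetric_bilinear_bound:
  fixes A :: "real mat"
  assumes A: "A \<in> carrier_mat n n" and n: "n > 0"
    and sym: "\<And>i j. i < n \<Longrightarrow> j < n \<Longrightarrow> A $$ (i, j) = A $$ (j, i)"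
    and row: "\<And>i. i < n \<Longrightarrow> (\<Sum>j<n. A $$ (i, j)) = d"
    and eig: "\<forall>\<mu> \<in># proots (char_poly A) - {#d#}. \<bar>\<mu>\<bar> \<le> lam"
  shows "(\<Sum>i<n. \<Sum>j<n. x i * (A $$ (i, j) - d / n) * y j)\<^sup>2
    \<le> lam\<^sup>2 * (\<Sum>i<n. (x i)\<^sup>2) * (\<Sum>i<n. (y i)\<^sup>2)"
proof -
  obtain es where es: "char_poly A = (\<Prod>e\<leftarrow>es. [:- e, 1:])" "length es = n"
    using real_symmetric_char_poly_splits[OF A sym] by blast
  have roots: "proots (char_poly A) = mset es"
    unfolding es(1) by (rule proots_linear_factors)
  have "eigenvector A (vec n (\<lambda>_. 1)) d"
    unfolding eigenvector_def using A n row
    by (auto simp: vec_eq_iff scalar_prod_def lessThan_atLeast0 intro!: eq_vecI)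
  then have "poly (char_poly A) d = 0"
    using eigenvalue_root_char_poly[OF A] unfolding eigenvalue_def by blast
  \<comment> \<open>This ensures that removing \<open>d\<close> from the multiset of roots really
    removes a summand from the trace below.\<close>
  then have d: "d \<in> set es" unfolding es poly_prod_list by (auto simp: prod_list_zero_iff)
  define b where "b m i j = (A ^\<^sub>m m) $$ (i, j) - d ^ m / n" for m i j
  have Am: "A ^\<^sub>m m \<in> carrier_mat n n" for m using A by simp
  have rows: "(\<Sum>j<n. (A ^\<^sub>m m) $$ (i, j)) = d ^ m" if "i < n" for m i
    by (rule row_sum_pow_mat[OF A row that])
  have bsym: "b m i j = b m j i" if "i < n" "j < n" for m i j
    unfolding b_def using symmetric_pow_mat[OF A sym that] by simp
  have cols: "(\<Sum>i<n. (A ^\<^sub>m m) $$ (i, j)) = d ^ m" if j: "j < n" for m j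
    using rows[OF j, of m] symmetric_pow_mat[OF A sym _ j, of _ m] by simp
  \<comment> \<open>Constant row and column sums turn both cross terms and the product of the two
    constant parts into \<open>d ^ (m + l) / n\<close>, with signs -1, -1 and +1.\<close>
  have bmult: "b (m + l) i j = (\<Sum>k<n. b m i k * b l k j)" if ij: "i < n" "j < n" for m l i j
  proof -
    have "(\<Sum>k<n. b m i k * b l k j) = (\<Sum>k<n. (A ^\<^sub>m m) $$ (i, k) * (A ^\<^sub>m l) $$ (k, j))
        - (\<Sum>k<n. (A ^\<^sub>m m) $$ (i, k)) * (d ^ l / n) - d ^ m / n * (\<Sum>k<n. (A ^\<^sub>m l) $$ (k, j))
        + (\<Sum>k<n. d ^ m / n * (d ^ l / n))"
      unfolding b_def sum_distrib_left sum_distrib_right sum.distrib[symmetric] sum_subtractf[symmetric]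
      by (intro sum.cong refl) (simp add: algebra_simps)
    also have "\<dots> = (A ^\<^sub>m (m + l)) $$ (i, j) - d ^ (m + l) / n"
      using n unfolding rows[OF ij(1)] cols[OF ij(2)] mat_mult_entry[OF Am Am ij, symmetric] pow_mat_add[OF A]
      by (simp add: power_add)
    finally show ?thesis by (simp add: b_def)
  qed
  have trace: "(\<Sum>i<n. b (2 * m) i i) \<le> n * (lam\<^sup>2) ^ m" for m
  proof -
    have "(\<Sum>i<n. b (2 * m) i i) = mat_trace (A ^\<^sub>m (2 * m)) - d ^ (2 * m)"
      using A n by (simp add: b_def sum_subtractf mat_trace_def)
    also have "mat_trace (A ^\<^sub>m (2 * m)) = (\<Sum>e\<in>#mset es. e ^ (2 * m))"
      unfolding mat_trace_pow[OF A es(1)] by (simp flip: sum_mset_sum_list)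
    also have "mset es = (mset es - {#d#}) + {#d#}" using d by simp
    also have "(\<Sum>e\<in>#(mset es - {#d#}) + {#d#}. e ^ (2 * m)) - d ^ (2 * m)
        = (\<Sum>e\<in>#mset es - {#d#}. e ^ (2 * m))" by simp
    also have "\<dots> \<le> (\<Sum>e\<in>#mset es - {#d#}. (lam\<^sup>2) ^ m)"
    proof (rule sum_mset_mono)
      fix e assume "e \<in># mset es - {#d#}"
      then have "\<bar>e\<bar> \<le> lam" using eig unfolding roots by blast
      then have "e\<^sup>2 \<le> lam\<^sup>2" by (metis abs_ge_zero power2_abs power_mono)
      then show "e ^ (2 * m) \<le> (lam\<^sup>2) ^ m" by (simp add: power_mult power_mono)
    qed
    also have "\<dots> = size (mset es - {#d#}) * (lam\<^sup>2) ^ m" by simp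
    also have "\<dots> \<le> n * (lam\<^sup>2) ^ m"
      using es(2) by (intro mult_right_mono) (auto simp: size_Diff_singleton_if)
    finally show ?thesis .
  qed
  have "(\<Sum>i<n. \<Sum>j<n. x i * b 1 i j * y j)\<^sup>2
    \<le> lam\<^sup>2 * (\<Sum>i<n. (x i)\<^sup>2) * (\<Sum>i<n. (y i)\<^sup>2)"
    by (rule bilinear_form_bound_from_traces[where c = n]) (use bsym bmult trace in auto)
  then show ?thesis using A by (simp add: b_def)
qed

section \<open>Hamilton cycles from rotations\<close>

definition consecutive :: "'a list \<Rightarrow> 'a \<Rightarrow> 'a \<Rightarrow> bool" where
  "consecutive Q x y \<longleftrightarrow> (\<exists>Q1 Q2. Q = Q1 @ [x, y] @ Q2)"

lemma consecutive_rev: "consecutive Q x y \<Longrightarrow> consecutive (rev Q) y x"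
proof -
  assume "consecutive Q x y"
  then obtain Q1 Q2 where "Q = Q1 @ [x, y] @ Q2" by (auto simp: consecutive_def)
  then have "rev Q = rev Q2 @ [y, x] @ rev Q1" by simp
  then show ?thesis unfolding consecutive_def by blast
qed

lemma consecutive_append1: "consecutive P x y \<Longrightarrow> consecutive (P @ Q) x y"
  unfolding consecutive_def by (metis append.assoc)

lemma consecutive_append2: "consecutive Q x y \<Longrightarrow> consecutive (P @ Q) x y"
  unfolding consecutive_def by (metis append.assoc)

lemma consecutive_nth: "Suc i < length xs \<Longrightarrow> consecutive xs (xs ! i) (xs ! Suc i)"
  unfolding consecutive_def
  by (rule exI[of _ "take i xs"], rule exI[of _ "drop (Suc (Suc i)) xs"])
    (simp add: Cons_nth_drop_Suc)

lemma consecutive_take: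
  "Suc i < a \<Longrightarrow> a \<le> length xs \<Longrightarrow> consecutive (take a xs) (xs ! i) (xs ! Suc i)"
  using consecutive_nth[of i "take a xs"] by simp

lemma consecutive_drop:
  assumes "b \<le> i" "Suc i < length xs"
  shows "consecutive (drop b xs) (xs ! i) (xs ! Suc i)"
  using consecutive_nth[of "i - b" "drop b xs"] assms by (simp add: Suc_diff_le)

lemma consecutive_slice:
  assumes "a \<le> i" "Suc i < b" "b \<le> length xs"
  shows "consecutive (drop a (take b xs)) (xs ! i) (xs ! Suc i)"
  using consecutive_drop[of a i "take b xs"] assms by simp

text \<open>The step from \<open>w\<close> to \<open>b\<close> is replaced by two new edges: walk
  from the head to \<open>w\<close>, jump to the last vertex, walk back to \<open>b\<close>, and
  return to the head.\<close>

lemma closing_rotation: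
  assumes sym: "\<And>u v. R u v \<Longrightarrow> R v u"
    and "distinct Q" "successively R Q" "consecutive Q w b"
    and "R (last Q) w" "R (hd Q) b"
  shows "\<exists>C. distinct C \<and> set C = set Q \<and> successively R C \<and> R (last C) (hd C)"
proof -
  from assms(4) obtain Q1 Q2 where Q: "Q = Q1 @ [w, b] @ Q2" by (auto simp: consecutive_def)
  have srev: "successively R (rev xs) \<longleftrightarrow> successively R xs" for xs
    unfolding successively_rev by (rule successively_cong) (use sym in blast)+
  let ?C = "Q1 @ [w] @ rev (b # Q2)"
  have "distinct ?C" using assms(2) unfolding Q by auto
  moreover have "set ?C = set Q" unfolding Q by auto
  moreover have "successively R ?C"
  proof -
    have "successively R Q1" "successively R (b # Q2)" "Q1 = [] \<or> R (last Q1) w"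
      using assms(3) unfolding Q by (simp_all add: successively_append_iff successively_Cons)
    moreover have "R w (last (b # Q2))" using sym[OF assms(5)] unfolding Q by simp
    then have "R w (hd (rev (b # Q2)))" by (simp only: hd_rev)
    ultimately show ?thesis
      using srev[of "b # Q2"]
      by (simp add: successively_append_iff successively_Cons del: successively_rev rev.simps)
  qed
  moreover have "R (last ?C) (hd ?C)"
    using sym[OF assms(6)] unfolding Q by (cases Q1) simp_all
  ultimately show ?thesis by blast
qed

section \<open>Selecting and ordering pivot positions\<close>

text \<open>Blocks are the sets of positions with a common value of \<open>i div s\<close>; the
  positions below \<open>m\<close> meet at most \<open>N div s + 1\<close> of them.\<close>

lemma pigeonhole_block:
  fixes A :: "nat set"
  assumes A: "A \<subseteq> {..<m}" and m: "m \<le> N" and K: "(N div s + 1) * K < card A"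
  obtains x where "K \<le> card {i \<in> A. i div s = x}"
proof (rule ccontr)
  assume "\<not> thesis"
  then have less: "card {i \<in> A. i div s = x} \<le> K" for x using that[of x] by linarith
  have fA: "finite A" using A finite_subset by blast
  have sub: "A \<subseteq> (\<Union>x\<le>N div s. {i \<in> A. i div s = x})"
  proof
    fix i assume "i \<in> A"
    moreover from this have "i div s \<le> N div s" using A m by (intro div_le_mono) auto
    ultimately show "i \<in> (\<Union>x\<le>N div s. {i \<in> A. i div s = x})" by blast
  qed
  have "card A \<le> (\<Sum>x\<le>N div s. card {i \<in> A. i div s = x})"
    by (rule order_trans[OF card_mono[OF _ sub] card_UN_le]) (use fA in auto)
  also have "\<dots> \<le> (\<Sum>x\<le>N div s. K)" by (rule sum_mono) (rule less)
  also have "\<dots> = (N div s + 1) * K" by simp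
  finally show False using K by simp
qed

text \<open>Cut at the least \<open>t\<close> for which \<open>k\<close> elements of
  \<open>A\<close> are at most \<open>t\<close>. Either \<open>B\<close> has \<open>k\<close>
  elements from \<open>t\<close> on, or it has \<open>k\<close> elements below \<open>t\<close>,
  while at most \<open>k\<close> elements of \<open>A\<close> are below \<open>t\<close> and so
  \<open>k\<close> are not. With all pivots of one end on one side of those of the other, a single
  formula describes all the rotated paths.\<close>

lemma ordered_halves:
  fixes A B :: "nat set"
  assumes fin: "finite A" "finite B" and cA: "2 * k \<le> card A" and cB: "2 * k \<le> card B"
  obtains A' B' where "A' \<subseteq> A" "B' \<subseteq> B" "k \<le> card A'" "k \<le> card B'"
    "(\<forall>a\<in>A'. \<forall>b\<in>B'. a \<le> b) \<or> (\<forall>a\<in>A'. \<forall>b\<in>B'. b < a)"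
proof -
  have ex: "\<exists>t. k \<le> card {a \<in> A. a \<le> t}"
  proof -
    obtain t where "\<forall>a\<in>A. a \<le> t" using fin(1) finite_nat_set_iff_bounded_le by blast
    then have "{a \<in> A. a \<le> t} = A" by auto
    then show ?thesis using cA by (intro exI[of _ t]) simp
  qed
  define t where "t = (LEAST t. k \<le> card {a \<in> A. a \<le> t})"
  have t1: "k \<le> card {a \<in> A. a \<le> t}" unfolding t_def using ex by (rule LeastI_ex)
  have t2: "card {a \<in> A. a < t} \<le> k"
  proof (cases t)
    case (Suc t')
    have "\<not> k \<le> card {a \<in> A. a \<le> t'}"
      using not_less_Least[of t' "\<lambda>t. k \<le> card {a \<in> A. a \<le> t}"] Suc unfolding t_def by simp
    then show ?thesis using Suc by (simp add: less_Suc_eq_le)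
  qed simp
  have split: "card X = card {a \<in> X. a < t} + card {a \<in> X. t \<le> a}" if "finite X" for X
  proof -
    have "X = {a \<in> X. a < t} \<union> {a \<in> X. t \<le> a}" by auto
    moreover have "card ({a \<in> X. a < t} \<union> {a \<in> X. t \<le> a}) = card {a \<in> X. a < t} + card {a \<in> X. t \<le> a}"
      by (rule card_Un_disjoint) (use that in auto)
    ultimately show ?thesis by metis
  qed
  show ?thesis
  proof (cases "k \<le> card {b \<in> B. t \<le> b}")
    case True
    show ?thesis
    proof (rule that[of "{a \<in> A. a \<le> t}" "{b \<in> B. t \<le> b}"])
      have "\<forall>a\<in>{a \<in> A. a \<le> t}. \<forall>b\<in>{b \<in> B. t \<le> b}. a \<le> b" by fastforce
      then show "(\<forall>a\<in>{a \<in> A. a \<le> t}. \<forall>b\<in>{b \<in> B. t \<le> b}. a \<le> b) \<or>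
        (\<forall>a\<in>{a \<in> A. a \<le> t}. \<forall>b\<in>{b \<in> B. t \<le> b}. b < a)" ..
    qed (use t1 True in simp_all)
  next
    case False
    show ?thesis
    proof (rule that[of "{a \<in> A. t \<le> a}" "{b \<in> B. b < t}"])
      show "k \<le> card {a \<in> A. t \<le> a}" using split[OF fin(1)] t2 cA by linarith
      show "k \<le> card {b \<in> B. b < t}" using split[OF fin(2)] False cB by linarith
      have "\<forall>a\<in>{a \<in> A. t \<le> a}. \<forall>b\<in>{b \<in> B. b < t}. b < a" by fastforce
      then show "(\<forall>a\<in>{a \<in> A. t \<le> a}. \<forall>b\<in>{b \<in> B. b < t}. a \<le> b) \<or>
        (\<forall>a\<in>{a \<in> A. t \<le> a}. \<forall>b\<in>{b \<in> B. b < t}. b < a)" ..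
    qed simp_all
  qed
qed

text \<open>Within a block, shifted by \<open>c\<close>, a position is determined by its residue
  modulo \<open>s\<close>.\<close>

lemma card_block:
  fixes c s x :: nat
  assumes "s \<ge> 1"
  shows "card {k. (k + c) div s = x} \<le> s" "finite {k. (k + c) div s = x}"
proof -
  have inj: "inj_on (\<lambda>k. (k + c) mod s) {k. (k + c) div s = x}"
  proof (rule inj_onI)
    fix k l assume kl: "k \<in> {k. (k + c) div s = x}" "l \<in> {k. (k + c) div s = x}"
      and m: "(k + c) mod s = (l + c) mod s"
    have d: "(k + c) div s = (l + c) div s" using kl by (simp only: mem_Collect_eq)
    have "k + c = (k + c) div s * s + (k + c) mod s" by (rule div_mult_mod_eq[symmetric])
    also have "\<dots> = l + c" unfolding d m by (rule div_mult_mod_eq)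
    finally have "k + c = l + c" .
    then show "k = l" by simp
  qed
  have sub: "(\<lambda>k. (k + c) mod s) ` {k. (k + c) div s = x} \<subseteq> {..<s}"
  proof
    fix y assume "y \<in> (\<lambda>k. (k + c) mod s) ` {k. (k + c) div s = x}"
    then obtain k where "y = (k + c) mod s" by blast
    then show "y \<in> {..<s}" using assms by simp
  qed
  show "card {k. (k + c) div s = x} \<le> s"
    using card_inj_on_le[OF inj sub finite_lessThan] by (simp only: card_lessThan)
  show "finite {k. (k + c) div s = x}"
    by (rule inj_on_finite[OF inj sub finite_lessThan])
qed

section \<open>Simultaneous rotation at both ends of a path\<close>

lemma last_take_nth: "0 < a \<Longrightarrow> a \<le> length p \<Longrightarrow> last (take a p) = p ! (a - 1)"
  by (subst last_conv_nth) auto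

text \<open>The first end has its pivot at the head of \<open>M\<close> and the last end at the last
  vertex of \<open>M\<close>, so the outer pieces flip independently. The new ends are
  \<open>last L\<close> and \<open>hd N\<close>.\<close>

lemma rotate_both_ends_uncrossed:
  assumes sym: "\<And>u v. R u v \<Longrightarrow> R v u"
    and "successively R (L @ M @ N)" "L \<noteq> []" "M \<noteq> []" "N \<noteq> []"
    and "R (hd L) (hd M)" "R (last N) (last M)"
  shows "successively R (rev L @ M @ rev N)"
proof -
  have srev: "successively R (rev xs) \<longleftrightarrow> successively R xs" for xs
    unfolding successively_rev by (rule successively_cong) (use sym in blast)+
  have "R (last M) (last N)" using sym[OF assms(7)] .
  then show ?thesis
    using assms(2-6)
    by (simp add: successively_append_iff srev hd_rev last_rev del: successively_rev)
qed

text \<open>Here the pivot of the last end, \<open>hd M\<close>, precedes that of the first end,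
  \<open>hd N\<close>. The pieces are rearranged so that only \<open>L\<close> keeps its direction,
  and the new ends are \<open>last M\<close> and \<open>last L\<close>.\<close>

lemma rotate_both_ends_crossed:
  assumes sym: "\<And>u v. R u v \<Longrightarrow> R v u"
    and "successively R (L @ M @ N)" "L \<noteq> []" "M \<noteq> []" "N \<noteq> []"
    and "R (hd L) (hd N)" "R (last N) (hd M)"
  shows "successively R (rev M @ rev N @ L)"
proof -
  have srev: "successively R (rev xs) \<longleftrightarrow> successively R xs" for xs
    unfolding successively_rev by (rule successively_cong) (use sym in blast)+
  have "R (hd M) (last N)" "R (hd N) (hd L)" using sym[OF assms(7)] sym[OF assms(6)] .
  then show ?thesis
    using assms(2-5)
    by (simp add: successively_append_iff srev hd_rev last_rev del: successively_rev)
qed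

section \<open>Closing a longest path\<close>

locale longest_path =
  fixes R :: "'a \<Rightarrow> 'a \<Rightarrow> bool" and W :: "'a set" and p :: "'a list"
  assumes fin: "finite W" and sym: "\<And>u v. R u v \<Longrightarrow> R v u" and irr: "\<And>v. \<not> R v v"
    and dist: "distinct p" and sub: "set p \<subseteq> W" and succ: "successively R p" and ne: "p \<noteq> []"
    and longest: "\<And>q. distinct q \<Longrightarrow> set q \<subseteq> W \<Longrightarrow> successively R q \<Longrightarrow> length q \<le> length p"
begin

text \<open>Any path on the vertices of \<open>p\<close> is a longest one too, and a neighbour of
  its end outside \<open>p\<close> would extend it.\<close>

lemma last_neighbour:
  assumes "distinct q" "set q = set p" "successively R q" "u \<in> W" "R (last q) u"
  shows "u \<in> set p"
proof (rule ccontr)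
  assume u: "u \<notin> set p"
  have "length q = length p" using assms(1,2) dist by (metis distinct_card)
  moreover have "length (q @ [u]) \<le> length p"
    by (rule longest) (use assms u sub in \<open>auto simp: successively_append_iff\<close>)
  ultimately show False by simp
qed

lemma hd_neighbour:
  assumes "u \<in> W" "R (hd p) u"
  shows "u \<in> set p"
proof (rule last_neighbour)
  show "successively R (rev p)"
    unfolding successively_rev by (rule successively_mono[OF succ]) (rule sym)
qed (use assms dist ne in \<open>simp_all add: last_rev\<close>)

text \<open>All paths \<open>Q a b\<close> agree on the successor \<open>\<phi> k\<close> of a
  position \<open>k\<close> in \<open>K\<close>. Hence the set \<open>T\<close> of successors of
  neighbours of last ends makes sense before \<open>a\<close> and \<open>b\<close> are chosen. It
  must meet the set \<open>NA\<close> of neighbours of first ends; only a common vertex then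
  determines \<open>a\<close> and \<open>b\<close>, and \<open>closing_rotation\<close> applies to
  that path.\<close>

lemma close_by_rotation:
  fixes f g \<phi> :: "nat \<Rightarrow> nat"
  assumes Q: "\<And>a b. a \<in> A \<Longrightarrow> b \<in> B \<Longrightarrow> distinct (Q a b) \<and> set (Q a b) = set p \<and>
      successively R (Q a b) \<and> hd (Q a b) = p ! f a \<and> last (Q a b) = p ! g b"
    and f: "inj_on f A" "f ` A \<subseteq> {..<length p}"
    and g: "inj_on g B" "g ` B \<subseteq> {..<length p}"
    and K: "K \<subseteq> {..<length p}" and \<phi>: "inj_on \<phi> K" "\<phi> ` K \<subseteq> {..<length p}"
    and cons: "\<And>a b k. a \<in> A \<Longrightarrow> b \<in> B \<Longrightarrow> k \<in> K \<Longrightarrow> consecutive (Q a b) (p ! k) (p ! \<phi> k)"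
    and cK: "card ({..<length p} - K) \<le> c"
    and k: "k \<ge> 1" "k \<le> card A" "k \<le> card B"
    and expand: "\<And>S. S \<subseteq> W \<Longrightarrow> k \<le> card S \<Longrightarrow> card W + c < 2 * card {v \<in> W. \<exists>u\<in>S. R u v}"
  shows "\<exists>C. distinct C \<and> set C = set p \<and> successively R C \<and> R (last C) (hd C)"
proof -
  have inj: "inj_on ((!) p) {..<length p}"
    using dist by (auto simp: inj_on_def nth_eq_iff_index_eq)
  have img: "card ((\<lambda>a. p ! h a) ` X) = card X \<and> (\<lambda>a. p ! h a) ` X \<subseteq> set p"
    if "inj_on h X" "h ` X \<subseteq> {..<length p}" for h and X :: "nat set"
  proof
    have "inj_on ((!) p \<circ> h) X"
      by (rule comp_inj_on[OF that(1)]) (rule inj_on_subset[OF inj that(2)])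
    then show "card ((\<lambda>a. p ! h a) ` X) = card X" by (simp add: card_image comp_def)
    show "(\<lambda>a. p ! h a) ` X \<subseteq> set p" using that(2) by auto
  qed
  obtain a0 where a0: "a0 \<in> A" using k by fastforce
  define SA where "SA = (\<lambda>a. p ! f a) ` A"
  define SB where "SB = (\<lambda>a. p ! g a) ` B"
  define NA where "NA = {v \<in> W. \<exists>u\<in>SA. R u v}"
  define NB where "NB = {v \<in> W. \<exists>u\<in>SB. R u v}"
  have cA: "card W + c < 2 * card NA" unfolding NA_def
    by (rule expand) (use img[OF f] k sub SA_def in auto)
  have cB: "card W + c < 2 * card NB" unfolding NB_def
    by (rule expand) (use img[OF g] k sub SB_def in auto)
  have NBp: "NB \<subseteq> set p"
  proof
    fix v assume "v \<in> NB"
    then obtain b where b: "b \<in> B" "R (p ! g b) v" and v: "v \<in> W" by (auto simp: NB_def SB_def)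
    show "v \<in> set p" by (rule last_neighbour[of "Q a0 b"]) (use Q[OF a0 b(1)] v b(2) in auto)
  qed
  define IB where "IB = {i. i < length p \<and> p ! i \<in> NB}"
  have "NB = (!) p ` IB" using NBp by (auto simp: IB_def in_set_conv_nth subset_iff)
  moreover have "inj_on ((!) p) IB" by (rule inj_on_subset[OF inj]) (auto simp: IB_def)
  ultimately have cIB: "card IB = card NB" by (simp add: card_image)
  have "IB \<subseteq> (IB \<inter> K) \<union> ({..<length p} - K)" by (auto simp: IB_def)
  then have "card IB \<le> card ((IB \<inter> K) \<union> ({..<length p} - K))"
    by (rule card_mono[rotated]) (auto simp: IB_def)
  also have "\<dots> \<le> card (IB \<inter> K) + c" using card_Un_le cK by (meson add_left_mono le_trans)
  finally have cIBK: "card NB \<le> card (IB \<inter> K) + c" using cIB by simp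
  define T where "T = (\<lambda>i. p ! \<phi> i) ` (IB \<inter> K)"
  have T: "card T = card (IB \<inter> K)" "T \<subseteq> set p"
    using img[of \<phi> "IB \<inter> K"] \<phi> unfolding T_def by (auto intro: inj_on_subset)
  \<comment> \<open>Passing from \<open>NB\<close> to \<open>T\<close> loses at most
    \<open>c\<close> vertices. The two expansion bounds add up to
    \<open>card W + c < card NA + card NB\<close>, which leaves no room for disjointness.\<close>
  have "T \<inter> NA \<noteq> {}"
  proof
    assume "T \<inter> NA = {}"
    then have "card T + card NA = card (T \<union> NA)"
      by (intro card_Un_disjoint[symmetric])
        (use fin finite_subset[OF T(2)] in \<open>auto simp: NA_def\<close>)
    also have "\<dots> \<le> card W" by (rule card_mono[OF fin]) (use T sub in \<open>auto simp: NA_def\<close>)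
    finally show False using cA cB cIBK T(1) by linarith
  qed
  then obtain i where i: "i \<in> IB" "i \<in> K" "p ! \<phi> i \<in> NA" by (auto simp: T_def)
  from i(3) obtain a where a: "a \<in> A" "R (p ! f a) (p ! \<phi> i)" by (auto simp: NA_def SA_def)
  from i(1) obtain b where b: "b \<in> B" "R (p ! g b) (p ! i)" by (auto simp: IB_def NB_def SB_def)
  have "\<exists>C. distinct C \<and> set C = set (Q a b) \<and> successively R C \<and> R (last C) (hd C)"
  proof (rule closing_rotation[OF _ _ _ cons[OF a(1) b(1) i(2)]])
    show "R u v \<Longrightarrow> R v u" for u v by (rule sym)
  qed (use Q[OF a(1) b(1)] a b in simp_all)
  then show ?thesis using Q[OF a(1) b(1)] by simp
qed

text \<open>Away from the pivot blocks \<open>x\<close> and \<open>y\<close>, the vertex following position \<open>k\<close> after both end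
  rotations depends only on \<open>k\<close>, not on the pivots chosen inside the blocks.\<close>

definition stable :: "nat \<Rightarrow> nat \<Rightarrow> nat \<Rightarrow> nat set" where
  "stable s x y = {k. 1 \<le> k \<and> k < length p \<and>
     (\<forall>j\<in>{k - 1, k, k + 1}. j div s \<noteq> x \<and> j div s \<noteq> y)}"

text \<open>Each of the blocks \<open>x\<close> and \<open>y\<close> is avoided by three translates
  of the position, which excludes six sets of at most \<open>s\<close> positions; position 0 is the
  extra one.\<close>

lemma card_not_stable:
  assumes "s \<ge> 1"
  shows "card ({..<length p} - stable s x y) \<le> 6 * s + 1"
proof -
  define F where "F c z = {k::nat. (k + c) div s = z}" for c z
  have F: "card (F c z) \<le> s" "finite (F c z)" for c z
    using card_block[OF assms] unfolding F_def by auto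
  have S: "card (Suc ` F c z) \<le> s" for c z using card_image_le[OF F(2), of Suc c z] F(1)[of c z] by simp
  have "{..<length p} - stable s x y \<subseteq>
      {0} \<union> F 0 x \<union> F 0 y \<union> F 1 x \<union> F 1 y \<union> Suc ` F 0 x \<union> Suc ` F 0 y" (is "_ \<subseteq> ?U")
  proof
    fix k assume k: "k \<in> {..<length p} - stable s x y"
    show "k \<in> ?U"
    proof (cases k)
      case (Suc l)
      then show ?thesis using k by (auto simp: stable_def F_def)
    qed simp
  qed
  then have "card ({..<length p} - stable s x y) \<le> card ?U"
    by (rule card_mono[rotated]) (use F in auto)
  also have "\<dots> \<le> 1 + s + s + s + s + s + s"
    by (intro order_trans[OF card_Un_le] add_mono F S) simp
  finally show ?thesis by simp
qed

text \<open>Blocks are intervals, so a position outside a block cannot separate two positions inside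
  it. This lets fixed pivots \<open>a0\<close> and \<open>b0\<close> represent all pivots of their
  blocks.\<close>

lemma same_side:
  fixes k a b :: nat
  assumes "k div s \<noteq> x" "a div s = x" "b div s = x"
  shows "a \<le> k \<longleftrightarrow> b \<le> k"
  using assms div_le_mono by (metis le_antisym nat_le_linear)

text \<open>Unless the ends are already adjacent, each end has at least \<open>2 * k\<close> pivots
  in one block, and halving them puts the two families in order. Expansion then applies to the
  \<open>k\<close> new ends on either side, its slack \<open>6 * s + 1\<close> paying for the
  positions that are not stable.\<close>

lemma longest_path_closes:
  assumes D: "\<And>v. v \<in> W \<Longrightarrow> D \<le> card {u \<in> W. R v u}"
    and s: "s \<ge> 1" and k: "k \<ge> 1" and Dk: "(card W div s + 1) * (2 * k) < D"
    and expand: "\<And>S. S \<subseteq> W \<Longrightarrow> k \<le> card S \<Longrightarrow>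
      card W + (6 * s + 1) < 2 * card {v \<in> W. \<exists>u\<in>S. R u v}"
  shows "\<exists>C. distinct C \<and> set C = set p \<and> successively R C \<and> R (last C) (hd C)"
proof (cases "R (last p) (hd p)")
  case True
  then show ?thesis using dist succ by blast
next
  case nR: False
  define m where "m = length p"
  have m: "m \<ge> 1" using ne by (simp add: m_def Suc_leI)
  have hd: "hd p = p ! 0" and last: "last p = p ! (m - 1)"
    using ne by (simp_all add: hd_conv_nth last_conv_nth m_def)
  have mW: "m \<le> card W" using card_mono[OF fin sub] dist by (simp add: distinct_card m_def)
  have indices: "D \<le> card {i. i < m \<and> R v (p ! i)}"
    if "v \<in> W" "{u \<in> W. R v u} \<subseteq> set p" for v
  proof -
    have "{u \<in> W. R v u} = (!) p ` {i. i < m \<and> R v (p ! i)}"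
      using that sub by (auto simp: in_set_conv_nth m_def subset_iff)
    then have "card {u \<in> W. R v u} \<le> card {i. i < m \<and> R v (p ! i)}"
      by (simp add: card_image_le)
    then show ?thesis using D[OF that(1)] by simp
  qed
  define A0 where "A0 = {i. i < m \<and> R (hd p) (p ! i)}"
  define B0 where "B0 = {i. i < m \<and> R (last p) (p ! i)}"
  have "D \<le> card A0" unfolding A0_def
    by (rule indices) (use ne sub hd_neighbour in auto)
  then obtain x where x: "2 * k \<le> card {i \<in> A0. i div s = x}"
    using pigeonhole_block[of A0 m "card W" s "2 * k"] mW Dk unfolding A0_def by auto
  have "D \<le> card B0" unfolding B0_def
    by (rule indices) (use ne sub last_neighbour[OF dist refl succ] in auto)
  then obtain y where y: "2 * k \<le> card {i \<in> B0. i div s = y}"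
    using pigeonhole_block[of B0 m "card W" s "2 * k"] mW Dk unfolding B0_def by auto
  have fAB: "finite {i \<in> A0. i div s = x}" "finite {i \<in> B0. i div s = y}"
    by (auto simp: A0_def B0_def)
  obtain A B where
    AB: "A \<subseteq> {i \<in> A0. i div s = x}" "B \<subseteq> {i \<in> B0. i div s = y}" "k \<le> card A" "k \<le> card B"
    and order: "(\<forall>a\<in>A. \<forall>b\<in>B. a \<le> b) \<or> (\<forall>a\<in>A. \<forall>b\<in>B. b < a)"
    by (rule ordered_halves[OF fAB x y])
  obtain a0 b0 where a0: "a0 \<in> A" and b0: "b0 \<in> B" using AB(3,4) k by fastforce
  have Am: "1 \<le> a" "a < m" "R (hd p) (p ! a)" "a div s = x" if "a \<in> A" for a
  proof -
    show "a < m" "R (hd p) (p ! a)" "a div s = x" using AB(1) that by (auto simp: A0_def)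
    then show "1 \<le> a" using irr hd by (cases a) auto
  qed
  \<comment> \<open>A pivot of the last end is not the last position, since there are no loops, and
    not position 0, since the ends are not adjacent. This keeps all three pieces of the path
    nonempty in both cases below.\<close>
  have Bm: "1 \<le> b" "b + 1 < m" "R (last p) (p ! b)" "b div s = y" if "b \<in> B" for b
  proof -
    show *: "R (last p) (p ! b)" "b div s = y" using AB(2) that by (auto simp: B0_def)
    have "b < m" using AB(2) that by (auto simp: B0_def)
    then show "b + 1 < m" using * irr last by (cases "b = m - 1") auto
    show "1 \<le> b" using * nR hd by (cases b) auto
  qed
  let ?K = "stable s x y"
  have Kx: "k div s \<noteq> x" "k div s \<noteq> y" "(k + 1) div s \<noteq> y" "(k - 1) div s \<noteq> y" "1 \<le> k" "k < m"
    if "k \<in> ?K" for k using that by (auto simp: stable_def m_def)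
  have sA: "a \<le> k \<longleftrightarrow> a0 \<le> k" if "k \<in> ?K" "a \<in> A" for a k
    using same_side[of k s x a a0] Kx that Am a0 by auto
  have sB: "b \<le> k \<longleftrightarrow> b0 \<le> k" if "k \<in> ?K" "b \<in> B" for b k
    using same_side[of k s y b b0] Kx that Bm b0 by auto
  have ndiv: "k \<noteq> a" "k \<noteq> b" "k + 1 \<noteq> b" "k - 1 \<noteq> b" if "k \<in> ?K" "a \<in> A" "b \<in> B" for a b k
    using Kx[OF that(1)] Am(4)[OF that(2)] Bm(4)[OF that(3)] by auto
  from order show ?thesis
  proof
    assume le: "\<forall>a\<in>A. \<forall>b\<in>B. a \<le> b"
    \<comment> \<open>The cuts lie before position \<open>a\<close> and after position
      \<open>b\<close>, so the new ends sit at \<open>a - 1\<close> and \<open>b + 1\<close>; the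
      case \<open>a = b\<close> is included.\<close>
    define Q where "Q a b = rev (take a p) @ drop a (take (b + 1) p) @ rev (drop (b + 1) p)" for a b
    \<comment> \<open>Only the middle piece keeps its direction, so successors there move up and
      elsewhere move down.\<close>
    define \<phi> where "\<phi> k = (if a0 \<le> k \<and> k < b0 then k + 1 else k - 1)" for k
    show ?thesis
    proof (rule close_by_rotation[where A = A and B = B and Q = Q and f = "\<lambda>a. a - 1" and g = "\<lambda>b. b + 1"
          and K = ?K and \<phi> = \<phi> and c = "6 * s + 1" and k = k])
      fix a b assume ab: "a \<in> A" "b \<in> B"
      note a = Am[OF ab(1)] and b = Bm[OF ab(2)]
      have l: "a \<le> b" using le ab by blast
      have pp: "p = take a p @ drop a (take (b + 1) p) @ drop (b + 1) p"
        using l by (metis (no_types, lifting) append_take_drop_id append.assoc le_add1 min.absorb1 order_trans take_take)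
      have dd: "distinct (take a p @ drop a (take (b + 1) p) @ drop (b + 1) p)"
        and ss: "set (take a p @ drop a (take (b + 1) p) @ drop (b + 1) p) = set p"
        and su: "successively R (take a p @ drop a (take (b + 1) p) @ drop (b + 1) p)"
        using dist succ pp by metis+
      have ne1: "take a p \<noteq> []" "drop a (take (b + 1) p) \<noteq> []" "drop (b + 1) p \<noteq> []"
        using a b l by (auto simp: m_def)
      have e: "hd (take a p) = hd p" "hd (drop a (take (b + 1) p)) = p ! a" "last (drop (b + 1) p) = last p"
        "last (drop a (take (b + 1) p)) = p ! b" "last (take a p) = p ! (a - 1)" "hd (drop (b + 1) p) = p ! (b + 1)"
        using a b l by (simp_all add: m_def hd_drop_conv_nth last_take_nth last_drop)
      have "successively R (Q a b)" unfolding Q_def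
        by (rule rotate_both_ends_uncrossed[OF sym su ne1]) (use a b e in simp_all)
      moreover have "distinct (Q a b)" using dd unfolding Q_def by auto
      moreover have "set (Q a b) = set p" using ss unfolding Q_def by auto
      moreover have "hd (Q a b) = p ! (a - 1)" using ne1 e unfolding Q_def by (simp add: hd_rev)
      moreover have "last (Q a b) = p ! (b + 1)" using ne1 e unfolding Q_def by (simp add: last_rev)
      ultimately show "distinct (Q a b) \<and> set (Q a b) = set p \<and> successively R (Q a b) \<and>
        hd (Q a b) = p ! (a - 1) \<and> last (Q a b) = p ! (b + 1)" by blast
      fix k assume kK: "k \<in> ?K"
      note kk = Kx[OF kK] and nn = ndiv[OF kK ab]
      consider "k < a" | "a \<le> k" "k < b" | "b < k" using nn by linarith
      then show "consecutive (Q a b) (p ! k) (p ! \<phi> k)"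
      proof cases
        case 1
        then have "\<phi> k = k - 1" using sA[OF kK ab(1)] by (auto simp: \<phi>_def)
        moreover have "consecutive (take a p) (p ! (k - 1)) (p ! k)"
          using consecutive_take[of "k - 1" a p] 1 kk a by (simp add: m_def)
        ultimately show ?thesis unfolding Q_def by (simp add: consecutive_append1 consecutive_rev)
      next
        case 2
        then have "\<phi> k = Suc k" using sA[OF kK ab(1)] sB[OF kK ab(2)] by (auto simp: \<phi>_def)
        moreover have "consecutive (drop a (take (b + 1) p)) (p ! k) (p ! Suc k)"
          by (rule consecutive_slice) (use 2 b in \<open>auto simp: m_def\<close>)
        ultimately show ?thesis unfolding Q_def by (simp add: consecutive_append1 consecutive_append2)
      next
        case 3
        then have "\<phi> k = k - 1" using sB[OF kK ab(2)] by (auto simp: \<phi>_def)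
        moreover have "consecutive (drop (b + 1) p) (p ! (k - 1)) (p ! k)"
          using consecutive_drop[of "b + 1" "k - 1" p] 3 kk nn by (auto simp: m_def)
        ultimately show ?thesis unfolding Q_def by (simp add: consecutive_append2 consecutive_rev)
      qed
    next
      show "inj_on (\<lambda>a. a - 1) A"
      proof (rule inj_onI)
        fix i j assume "i \<in> A" "j \<in> A" "i - 1 = j - 1"
        then show "i = j" using Am(1)[of i] Am(1)[of j] by linarith
      qed
      show "(\<lambda>a. a - 1) ` A \<subseteq> {..<length p}" using Am by (fastforce simp: m_def)
      show "(\<lambda>b. b + 1) ` B \<subseteq> {..<length p}" using Bm by (fastforce simp: m_def)
      \<comment> \<open>A collision needs \<open>j = i + 2\<close> with \<open>i\<close> in the
        middle piece and \<open>j\<close> beyond it. Then \<open>b0\<close> is \<open>i + 1\<close>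
        or \<open>j\<close>, which stability excludes.\<close>
      show "inj_on \<phi> ?K"
      proof (rule inj_onI)
        fix i j assume ij: "i \<in> ?K" "j \<in> ?K" "\<phi> i = \<phi> j"
        obtain i' j' where "i = Suc i'" "j = Suc j'"
          using Kx(5)[OF ij(1)] Kx(5)[OF ij(2)] by (metis One_nat_def Suc_le_D)
        then show "i = j" using ij(3) ndiv[OF ij(1) a0 b0] ndiv[OF ij(2) a0 b0]
          le[rule_format, OF a0 b0]
          by (simp add: \<phi>_def split: if_split_asm)
      qed
      show "\<phi> ` ?K \<subseteq> {..<length p}"
        using Kx Bm[OF b0] by (fastforce simp: \<phi>_def m_def)
      show "?K \<subseteq> {..<length p}" by (auto simp: stable_def)
      show "card ({..<length p} - ?K) \<le> 6 * s + 1" by (rule card_not_stable[OF s])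
    qed (use k AB expand in auto)
  next
    assume less: "\<forall>a\<in>A. \<forall>b\<in>B. b < a"
    \<comment> \<open>The cuts now lie before \<open>b\<close> and before \<open>a\<close>, and the
      new ends sit at \<open>a - 1\<close> and \<open>b - 1\<close>. Only the initial piece keeps
      its direction, which explains the simpler \<open>\<phi>\<close>.\<close>
    define Q where "Q a b = rev (drop b (take a p)) @ rev (drop a p) @ take b p" for a b
    define \<phi> where "\<phi> k = (if k < b0 then k + 1 else k - 1)" for k
    show ?thesis
    proof (rule close_by_rotation[where A = A and B = B and Q = Q and f = "\<lambda>a. a - 1" and g = "\<lambda>b. b - 1"
          and K = ?K and \<phi> = \<phi> and c = "6 * s + 1" and k = k])
      fix a b assume ab: "a \<in> A" "b \<in> B"
      note a = Am[OF ab(1)] and b = Bm[OF ab(2)]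
      have l: "b < a" using less ab by blast
      have pp: "p = take b p @ drop b (take a p) @ drop a p"
        using l by (metis (no_types, lifting) append_take_drop_id append.assoc less_imp_le min.absorb1 take_take)
      have dd: "distinct (take b p @ drop b (take a p) @ drop a p)"
        and ss: "set (take b p @ drop b (take a p) @ drop a p) = set p"
        and su: "successively R (take b p @ drop b (take a p) @ drop a p)"
        using dist succ pp by metis+
      have ne1: "take b p \<noteq> []" "drop b (take a p) \<noteq> []" "drop a p \<noteq> []"
        using a b l by (auto simp: m_def)
      have e: "hd (take b p) = hd p" "hd (drop b (take a p)) = p ! b" "last (drop a p) = last p"
        "last (drop b (take a p)) = p ! (a - 1)" "last (take b p) = p ! (b - 1)" "hd (drop a p) = p ! a"
        using a b l by (simp_all add: m_def hd_drop_conv_nth last_take_nth last_drop)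
      have "successively R (Q a b)" unfolding Q_def
        by (rule rotate_both_ends_crossed[OF sym su ne1]) (use a b e in simp_all)
      moreover have "distinct (Q a b)" using dd unfolding Q_def by auto
      moreover have "set (Q a b) = set p" using ss unfolding Q_def by auto
      moreover have "hd (Q a b) = p ! (a - 1)" using ne1 e unfolding Q_def by (simp add: hd_rev)
      moreover have "last (Q a b) = p ! (b - 1)" using ne1 e unfolding Q_def by simp
      ultimately show "distinct (Q a b) \<and> set (Q a b) = set p \<and> successively R (Q a b) \<and>
        hd (Q a b) = p ! (a - 1) \<and> last (Q a b) = p ! (b - 1)" by blast
      fix k assume kK: "k \<in> ?K"
      note kk = Kx[OF kK] and nn = ndiv[OF kK ab]
      consider "k < b" | "b < k" "k < a" | "a < k" using nn by linarith
      then show "consecutive (Q a b) (p ! k) (p ! \<phi> k)"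
      proof cases
        case 1
        then have "\<phi> k = Suc k" using sB[OF kK ab(2)] by (auto simp: \<phi>_def)
        moreover have "consecutive (take b p) (p ! k) (p ! Suc k)"
          using consecutive_take[of k b p] 1 nn b by (simp add: m_def)
        ultimately show ?thesis unfolding Q_def by (simp add: consecutive_append2)
      next
        case 2
        then have "\<phi> k = k - 1" using sB[OF kK ab(2)] by (auto simp: \<phi>_def)
        moreover have "consecutive (drop b (take a p)) (p ! (k - 1)) (p ! k)"
          using consecutive_slice[of b "k - 1" a p] 2 a kk by (auto simp: m_def)
        ultimately show ?thesis unfolding Q_def by (simp add: consecutive_append1 consecutive_rev)
      next
        case 3
        then have "\<phi> k = k - 1" using sB[OF kK ab(2)] l by (auto simp: \<phi>_def)
        moreover have "consecutive (drop a p) (p ! (k - 1)) (p ! k)"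
          using consecutive_drop[of a "k - 1" p] 3 kk nn by (auto simp: m_def)
        ultimately show ?thesis unfolding Q_def
          by (simp add: consecutive_append1 consecutive_append2 consecutive_rev)
      qed
    next
      show "inj_on (\<lambda>a. a - 1) A"
      proof (rule inj_onI)
        fix i j assume "i \<in> A" "j \<in> A" "i - 1 = j - 1"
        then show "i = j" using Am(1)[of i] Am(1)[of j] by linarith
      qed
      show "inj_on (\<lambda>b. b - 1) B"
      proof (rule inj_onI)
        fix i j assume "i \<in> B" "j \<in> B" "i - 1 = j - 1"
        then show "i = j" using Bm(1)[of i] Bm(1)[of j] by linarith
      qed
      show "(\<lambda>a. a - 1) ` A \<subseteq> {..<length p}" using Am by (fastforce simp: m_def)
      show "(\<lambda>b. b - 1) ` B \<subseteq> {..<length p}" using Bm by (fastforce simp: m_def)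
      show "inj_on \<phi> ?K"
      proof (rule inj_onI)
        fix i j assume ij: "i \<in> ?K" "j \<in> ?K" "\<phi> i = \<phi> j"
        obtain i' j' where "i = Suc i'" "j = Suc j'"
          using Kx(5)[OF ij(1)] Kx(5)[OF ij(2)] by (metis One_nat_def Suc_le_D)
        then show "i = j" using ij(3) ndiv[OF ij(1) a0 b0] ndiv[OF ij(2) a0 b0]
          by (simp add: \<phi>_def split: if_split_asm)
      qed
      show "\<phi> ` ?K \<subseteq> {..<length p}"
        using Kx Bm[OF b0] by (fastforce simp: \<phi>_def m_def)
      show "?K \<subseteq> {..<length p}" by (auto simp: stable_def)
      show "card ({..<length p} - ?K) \<le> 6 * s + 1" by (rule card_not_stable[OF s])
    qed (use k AB expand in auto)
  qed
qed

end

text \<open>A longest path closes to a cycle, and no edge leaves that cycle because it can be opened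
  at any vertex. So the cycle and its complement are both closed under neighbours; a nonempty closed
  set fills more than half of \<open>W\<close>, hence the complement is empty.\<close>

lemma hamilton_cycle_expanding:
  fixes R :: "'a \<Rightarrow> 'a \<Rightarrow> bool"
  assumes fin: "finite W" and sym: "\<And>u v. R u v \<Longrightarrow> R v u" and irr: "\<And>v. \<not> R v v"
    and D: "\<And>v. v \<in> W \<Longrightarrow> D \<le> card {u \<in> W. R v u}"
    and s: "s \<ge> 1" and k: "k \<ge> 1" and Dk: "(card W div s + 1) * (2 * k) < D"
    and expand: "\<And>S. S \<subseteq> W \<Longrightarrow> k \<le> card S \<Longrightarrow>
      card W + (6 * s + 1) < 2 * card {v \<in> W. \<exists>u\<in>S. R u v}"
    and W: "W \<noteq> {}"
  obtains C where "distinct C" "set C = W" "successively R C" "R (last C) (hd C)"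
proof -
  define P where "P q \<longleftrightarrow> distinct q \<and> set q \<subseteq> W \<and> successively R q" for q
  obtain w where w: "w \<in> W" using W by blast
  have P1: "P [w]" using w by (simp add: P_def)
  have bound: "\<forall>q. P q \<longrightarrow> length q \<le> card W"
  proof (intro allI impI)
    fix q assume q: "P q"
    then have "length q = card (set q)" by (simp add: P_def distinct_card)
    also have "\<dots> \<le> card W" using q by (intro card_mono[OF fin]) (simp add: P_def)
    finally show "length q \<le> card W" .
  qed
  have "\<exists>p. P p \<and> (\<forall>q. P q \<longrightarrow> length q \<le> length p)"
    by (rule ex_has_greatest_nat[where P = P and b = "Suc (card W)", OF P1])
      (use bound in \<open>simp add: less_Suc_eq_le\<close>)
  then obtain p where p: "P p" "\<forall>q. P q \<longrightarrow> length q \<le> length p" by blast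
  have ne: "p \<noteq> []" using p(2)[rule_format, OF P1] by auto
  interpret longest_path R W p
  proof
    show "R u v \<Longrightarrow> R v u" for u v by (rule sym)
    show "\<not> R v v" for v by (rule irr)
  qed (use fin p ne in \<open>auto simp: P_def\<close>)
  have "\<exists>C. distinct C \<and> set C = set p \<and> successively R C \<and> R (last C) (hd C)"
    by (rule longest_path_closes[OF D s k Dk expand])
  then obtain C where C: "distinct C" "set C = set p" "successively R C" "R (last C) (hd C)"
    by blast
  have nonleaving: "v \<in> set p" if u: "u \<in> set p" and v: "v \<in> W" "R u v" for u v
  proof -
    from u C(2) obtain C1 C2 where CC: "C = C1 @ u # C2" by (metis split_list)
    show ?thesis
    proof (rule last_neighbour)
      let ?q = "C2 @ C1 @ [u]"
      show "distinct ?q" "set ?q = set p" using C(1,2) unfolding CC by auto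
      show "successively R ?q"
        using C(3,4) unfolding CC
        by (cases "C1 = []"; cases "C2 = []") (auto simp: successively_append_iff successively_Cons)
      show "v \<in> W" "R (last ?q) v" using v by auto
    qed
  qed
  have kD: "k \<le> D"
  proof -
    have "k \<le> (card W div s + 1) * (2 * k)" by simp
    then show ?thesis using Dk by linarith
  qed
  \<comment> \<open>A nonempty closed set contains a whole neighbourhood, so it has at least
    \<open>D\<close> and thus at least \<open>k\<close> elements, and expansion applies to the set
    itself.\<close>
  have large: "card W < 2 * card X"
    if X: "X \<subseteq> W" "X \<noteq> {}" and cl: "\<And>u v. u \<in> X \<Longrightarrow> v \<in> W \<Longrightarrow> R u v \<Longrightarrow> v \<in> X" for X
  proof -
    obtain u where u: "u \<in> X" using X by blast
    have fX: "finite X" using X fin finite_subset by blast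
    have "{v \<in> W. R u v} \<subseteq> X" using cl u by blast
    then have "D \<le> card X" using D[of u] u X card_mono[OF fX] by (meson le_trans subsetD)
    then have "card W + (6 * s + 1) < 2 * card {v \<in> W. \<exists>u\<in>X. R u v}"
      using expand[OF X(1)] kD by simp
    also have "card {v \<in> W. \<exists>u\<in>X. R u v} \<le> card X" by (rule card_mono[OF fX]) (use cl in auto)
    finally show ?thesis by simp
  qed
  have "set p = W"
  proof (rule ccontr)
    assume "set p \<noteq> W"
    then have ne2: "W - set p \<noteq> {}" using sub by blast
    have "card W < 2 * card (set p)" by (rule large) (use sub ne nonleaving in auto)
    moreover have "card W < 2 * card (W - set p)"
      by (rule large) (use ne2 nonleaving sym in blast)+
    moreover have "card (W - set p) = card W - card (set p)" by (rule card_Diff_subset) (use sub in auto)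
    ultimately show False using card_mono[OF fin sub] by linarith
  qed
  then show thesis using that C by simp
qed

section \<open>Balanced subsets and twisted triangles\<close>

text \<open>Ordered pairs are counted, so an edge inside \<open>X \<inter> Y\<close> contributes
  twice. The relation is arbitrary, which allows one side to be composed with a permutation.\<close>

definition edge_count :: "('a \<Rightarrow> 'a \<Rightarrow> bool) \<Rightarrow> 'a set \<Rightarrow> 'a set \<Rightarrow> real" where
  "edge_count R X Y = (\<Sum>x\<in>X. \<Sum>y\<in>Y. of_bool (R x y))"

lemma edge_count_filter:
  assumes "finite X" "finite Y"
  shows "edge_count R {x \<in> X. P x} {y \<in> Y. Q y} =
    (\<Sum>x\<in>X. \<Sum>y\<in>Y. of_bool (P x) * (of_bool (Q y) * of_bool (R x y)))"
proof -
  have "edge_count R {x \<in> X. P x} {y \<in> Y. Q y} =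
      (\<Sum>x\<in>X. if P x then \<Sum>y\<in>Y. if Q y then of_bool (R x y) else 0 else 0)"
    unfolding edge_count_def sum.inter_filter[OF assms(1)] sum.inter_filter[OF assms(2)] ..
  also have "\<dots> = (\<Sum>x\<in>X. \<Sum>y\<in>Y. of_bool (P x) * (of_bool (Q y) * of_bool (R x y)))"
    by (intro sum.cong refl) (auto intro!: sum.cong)
  finally show ?thesis .
qed

section \<open>Random subsets with controlled degrees\<close>

text \<open>For \<open>p\<close> between 0 and 1 this is the generating function of a binomial
  variable: \<open>Z\<close> picks each vertex independently with probability \<open>p\<close>. It
  is the expansion of a product over the vertices.\<close>

lemma random_subset_moment:
  fixes p x :: real
  assumes V: "finite V" and N: "N \<subseteq> V"
  shows "(\<Sum>Z\<in>Pow V. p ^ card Z * (1 - p) ^ card (V - Z) * x ^ card (N \<inter> Z)) = (1 - p + p * x) ^ card N"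
proof -
  have "(\<Sum>Z\<in>Pow V. p ^ card Z * (1 - p) ^ card (V - Z) * x ^ card (N \<inter> Z))
      = (\<Sum>Z\<in>Pow V. (\<Prod>v\<in>Z. p * (if v \<in> N then x else 1)) * (\<Prod>v\<in>V - Z. 1 - p))"
  proof (intro sum.cong refl)
    fix Z assume "Z \<in> Pow V"
    then have "finite Z" using V finite_subset by blast
    then have "(\<Prod>v\<in>Z. if v \<in> N then x else 1) = x ^ card (N \<inter> Z)"
      by (simp add: prod.If_cases Int_commute)
    then show "p ^ card Z * (1 - p) ^ card (V - Z) * x ^ card (N \<inter> Z)
      = (\<Prod>v\<in>Z. p * (if v \<in> N then x else 1)) * (\<Prod>v\<in>V - Z. 1 - p)"
      by (simp add: prod.distrib)
  qed
  also have "\<dots> = (\<Prod>v\<in>V. p * (if v \<in> N then x else 1) + (1 - p))"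
    by (rule prod_add[OF V, symmetric])
  also have "\<dots> = (\<Prod>v\<in>V. if v \<in> N then 1 - p + p * x else 1)"
    by (intro prod.cong refl) auto
  also have "\<dots> = (1 - p + p * x) ^ card N"
    using V N by (simp add: prod.If_cases Int_absorb1)
  finally show ?thesis .
qed

text \<open>A Chernoff bound with a union bound, written as a weighted average over all subsets. The
  average of \<open>\<Phi>\<close> is below 1, so some \<open>Z\<close> has
  \<open>\<Phi> Z < 1\<close>.\<close>

lemma exists_balanced_subset:
  fixes p d :: real and N M :: "'a \<Rightarrow> 'a set"
  assumes V: "finite V" and p: "0 \<le> p" "p \<le> 1"
    and N: "\<And>v. v \<in> V \<Longrightarrow> N v \<subseteq> V \<and> real (card (N v)) \<le> d"
    and M: "\<And>v. v \<in> V \<Longrightarrow> M v \<subseteq> V \<and> d / 2 \<le> real (card (M v))"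
    and d: "0 \<le> d" and small: "2 * real (card V) < exp (p * d / 8)"
  obtains Z where "Z \<subseteq> V" "\<And>v. v \<in> V \<Longrightarrow> real (card (N v \<inter> Z)) < 3 * p * d"
    "\<And>v. v \<in> V \<Longrightarrow> p * d / 8 < real (card (M v \<inter> Z))"
proof -
  define w where "w Z = p ^ card Z * (1 - p) ^ card (V - Z)" for Z
  \<comment> \<open>A set violating one of the two bounds at some \<open>v\<close> makes the
    corresponding summand at least 1.\<close>
  define \<Phi> where "\<Phi> Z = (\<Sum>v\<in>V. exp (- 3 * p * d) * exp 1 ^ card (N v \<inter> Z)
      + exp (p * d / 8) * exp (- 1) ^ card (M v \<inter> Z))" for Z
  have w0: "w Z \<ge> 0" for Z using p by (simp add: w_def)
  have total: "(\<Sum>Z\<in>Pow V. w Z) = 1"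
    using random_subset_moment[OF V empty_subsetI, of p 1] by (simp add: w_def)
  have upper: "exp (- 3 * p * d) * (\<Sum>Z\<in>Pow V. w Z * exp 1 ^ card (N v \<inter> Z)) \<le> exp (- (p * d / 8))"
    if v: "v \<in> V" for v
  proof -
    \<comment> \<open>This makes each factor at most \<open>exp (2 * p)\<close>; the threshold
      \<open>3 * p * d\<close> then leaves \<open>exp (- (p * d))\<close>.\<close>
    have e: "exp 1 \<le> (3::real)" by (rule exp_le)
    have "(\<Sum>Z\<in>Pow V. w Z * exp 1 ^ card (N v \<inter> Z)) = (1 - p + p * exp 1) ^ card (N v)"
      unfolding w_def using random_subset_moment[OF V, of "N v" p "exp 1"] N[OF v] by simp
    also have "\<dots> \<le> exp (2 * p) ^ card (N v)"
    proof (rule power_mono)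
      have "1 - p + p * exp 1 \<le> 1 + 2 * p" using mult_left_mono[OF e p(1)] by simp
      also have "\<dots> \<le> exp (2 * p)" by (rule exp_ge_add_one_self)
      finally show "1 - p + p * exp 1 \<le> exp (2 * p)" .
    qed (use p in simp)
    also have "\<dots> = exp (card (N v) * (2 * p))" by (rule exp_of_nat_mult[symmetric])
    also have "\<dots> \<le> exp (d * (2 * p))" using mult_right_mono[of "card (N v)" d "2 * p"] N[OF v] p by simp
    finally have "exp (- 3 * p * d) * (\<Sum>Z\<in>Pow V. w Z * exp 1 ^ card (N v \<inter> Z))
        \<le> exp (- 3 * p * d) * exp (d * (2 * p))" by simp
    also have "\<dots> = exp (- (p * d))" by (simp add: exp_add[symmetric])
    also have "\<dots> \<le> exp (- (p * d / 8))" using p d by simp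
    finally show ?thesis .
  qed
  have lower: "exp (p * d / 8) * (\<Sum>Z\<in>Pow V. w Z * exp (- 1) ^ card (M v \<inter> Z)) \<le> exp (- (p * d / 8))"
    if v: "v \<in> V" for v
  proof -
    have "2 \<le> exp (1::real)" using exp_ge_add_one_self[of 1] by simp
    \<comment> \<open>This makes each factor at most \<open>exp (- (p / 2))\<close>. At least
      \<open>d / 2\<close> factors give \<open>exp (- (p * d / 4))\<close>, half of whose exponent
      is spent on the threshold.\<close>
    then have e: "exp (- 1) \<le> 1 / (2::real)" by (simp add: exp_minus field_simps)
    have "(\<Sum>Z\<in>Pow V. w Z * exp (- 1) ^ card (M v \<inter> Z)) = (1 - p + p * exp (- 1)) ^ card (M v)"
      unfolding w_def using random_subset_moment[OF V, of "M v" p "exp (- 1)"] M[OF v] by simp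
    also have "\<dots> \<le> exp (- (p / 2)) ^ card (M v)"
    proof (rule power_mono)
      have "1 - p + p * exp (- 1) \<le> 1 + - (p / 2)" using mult_left_mono[OF e p(1)] by simp
      also have "\<dots> \<le> exp (- (p / 2))" by (rule exp_ge_add_one_self)
      finally show "1 - p + p * exp (- 1) \<le> exp (- (p / 2))" .
    qed (use p in simp)
    also have "\<dots> = exp (card (M v) * (- (p / 2)))" by (rule exp_of_nat_mult[symmetric])
    also have "\<dots> \<le> exp (- (p * d / 4))"
      using mult_right_mono[of "d / 2" "card (M v)" "p / 2"] M[OF v] p by (simp add: mult_ac)
    finally have "exp (p * d / 8) * (\<Sum>Z\<in>Pow V. w Z * exp (- 1) ^ card (M v \<inter> Z))
        \<le> exp (p * d / 8) * exp (- (p * d / 4))" by simp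
    also have "\<dots> = exp (- (p * d / 8))" by (simp add: exp_add[symmetric])
    finally show ?thesis .
  qed
  have "(\<Sum>Z\<in>Pow V. w Z * \<Phi> Z) =
      (\<Sum>v\<in>V. exp (- 3 * p * d) * (\<Sum>Z\<in>Pow V. w Z * exp 1 ^ card (N v \<inter> Z))
        + exp (p * d / 8) * (\<Sum>Z\<in>Pow V. w Z * exp (- 1) ^ card (M v \<inter> Z)))"
    unfolding \<Phi>_def sum_distrib_left sum.distrib[symmetric]
    by (subst sum.swap) (simp add: algebra_simps)
  also have "\<dots> \<le> (\<Sum>v\<in>V. exp (- (p * d / 8)) + exp (- (p * d / 8)))"
    by (intro sum_mono add_mono upper lower)
  also have "\<dots> = 2 * real (card V) * exp (- (p * d / 8))" by simp
  also have "\<dots> < 1" using small by (simp add: exp_minus field_simps)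
  finally have less: "(\<Sum>Z\<in>Pow V. w Z * \<Phi> Z) < (\<Sum>Z\<in>Pow V. w Z)" using total by simp
  have "\<exists>Z\<in>Pow V. \<Phi> Z < 1"
  proof (rule ccontr)
    assume "\<not> ?thesis"
    then have "w Z \<le> w Z * \<Phi> Z" if "Z \<in> Pow V" for Z
      using that w0[of Z] mult_left_mono[of 1 "\<Phi> Z" "w Z"] by (simp add: not_less)
    then have "(\<Sum>Z\<in>Pow V. w Z) \<le> (\<Sum>Z\<in>Pow V. w Z * \<Phi> Z)" by (rule sum_mono)
    then show False using less by simp
  qed
  then obtain Z where Z: "Z \<subseteq> V" "\<Phi> Z < 1" by blast
  have each: "exp (- 3 * p * d) * exp 1 ^ card (N v \<inter> Z) < 1 \<and> exp (p * d / 8) * exp (- 1) ^ card (M v \<inter> Z) < 1"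
    if v: "v \<in> V" for v
  proof -
    have "exp (- 3 * p * d) * exp 1 ^ card (N v \<inter> Z) + exp (p * d / 8) * exp (- 1) ^ card (M v \<inter> Z) \<le> \<Phi> Z"
      unfolding \<Phi>_def using V v by (intro member_le_sum) (auto intro!: add_nonneg_nonneg mult_nonneg_nonneg)
    then have *: "exp (- 3 * p * d) * exp 1 ^ card (N v \<inter> Z) + exp (p * d / 8) * exp (- 1) ^ card (M v \<inter> Z) < 1"
      using Z(2) by linarith
    have "0 < exp (- 3 * p * d) * exp 1 ^ card (N v \<inter> Z)" "0 < exp (p * d / 8) * exp (- 1) ^ card (M v \<inter> Z)"
      by simp_all
    then show ?thesis using * by linarith
  qed
  show thesis
  proof (rule that[OF Z(1)])
    fix v assume v: "v \<in> V"
    have pow: "exp x ^ k = exp (real k * x)" for x :: real and k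
      by (rule exp_of_nat_mult[symmetric])
    have "exp (- 3 * p * d + real (card (N v \<inter> Z)) * 1) < exp 0"
      using each[OF v] unfolding pow exp_add[symmetric] by simp
    then show "real (card (N v \<inter> Z)) < 3 * p * d" by simp
    have "exp (p * d / 8 + real (card (M v \<inter> Z)) * (- 1)) < exp 0"
      using each[OF v] unfolding pow exp_add[symmetric] by simp
    then show "p * d / 8 < real (card (M v \<inter> Z))" by simp
  qed
qed

section \<open>Triangles twisted by a permutation\<close>

text \<open>Double counting by contradiction. Mixing is available for \<open>E\<close> only, so one
  edge of each triple is counted in \<open>E\<close>. If no triple survives, every counted one has
  its edge \<open>x y\<close> deleted, and such triples are recounted from \<open>x\<close>.\<close>

lemma twisted_triangle:
  fixes E F :: "'a \<Rightarrow> 'a \<Rightarrow> bool" and d \<delta> \<gamma> \<eta> n :: real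
  assumes fin: "finite V" and Z: "Z \<subseteq> V" "Z \<noteq> {}" and W: "W = V - Z" and \<sigma>: "bij_betw \<sigma> W W"
    and symF: "\<And>u v. F u v \<Longrightarrow> F v u" and FE: "\<And>u v. F u v \<Longrightarrow> E u v"
    and n: "n > 0" and d: "d > 0"
    and deg: "\<And>v. v \<in> V \<Longrightarrow> real (card {u \<in> V. E v u}) \<le> d"
    and mixing: "\<And>X Y. X \<subseteq> V \<Longrightarrow> Y \<subseteq> V \<Longrightarrow>
      \<bar>edge_count E X Y - d * real (card X) * real (card Y) / n\<bar> \<le> \<delta> * d\<^sup>2 / n * sqrt (real (card X) * real (card Y))"
    and \<delta>: "\<delta> \<ge> 0"
    and degZ: "\<And>v. v \<in> Z \<Longrightarrow> \<gamma> * d \<le> real (card {u \<in> Z. F v u})"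
    and degW: "\<And>v. v \<in> Z \<Longrightarrow>
      real (card {u \<in> W. E v u \<and> \<not> F v u}) + \<eta> * d \<le> real (card {u \<in> W. F v u})"
    and \<eta>: "\<eta> \<ge> 0" and small: "2 * \<delta> < \<gamma> * \<eta>"
  obtains v x y where "v \<in> Z" "x \<in> Z" "y \<in> W" "F v x" "F x y" "F (\<sigma> y) v"
proof (rule ccontr)
  assume no: "\<not> thesis"
  note found = that
  have none: "\<not> (F v x \<and> F x y \<and> F v (\<sigma> y))" if "v \<in> Z" "x \<in> Z" "y \<in> W" for v x y
  proof
    assume "F v x \<and> F x y \<and> F v (\<sigma> y)"
    then show False using no found[OF that] symF[of v "\<sigma> y"] by blast
  qed
  have finZ: "finite Z" "finite W" using fin Z(1) W finite_subset by auto
  have WV: "W \<subseteq> V" using W by blast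
  define z where "z v = real (card {u \<in> Z. F v u})" for v
  define w where "w v = real (card {u \<in> W. F v u})" for v
  define h where "h v = real (card {u \<in> W. E v u \<and> \<not> F v u})" for v
  have le_d: "z v \<le> d" "w v \<le> d" "h v \<le> d" if v: "v \<in> Z" for v
  proof -
    have vV: "v \<in> V" using v Z by blast
    have *: "real (card S) \<le> d" if S: "S \<subseteq> {u \<in> V. E v u}" for S
    proof -
      have "card S \<le> card {u \<in> V. E v u}" by (rule card_mono[OF _ S]) (simp add: fin)
      then show ?thesis using deg[OF vV] by linarith
    qed
    show "z v \<le> d" unfolding z_def by (rule *) (use FE Z(1) in blast)
    show "w v \<le> d" unfolding w_def by (rule *) (use FE WV in blast)
    show "h v \<le> d" unfolding h_def by (rule *) (use WV in blast)
  qed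
  have sqrt_le_d: "sqrt (a * b) \<le> d" if "0 \<le> a" "a \<le> d" "0 \<le> b" "b \<le> d" for a b :: real
    using that d by (intro real_le_lsqrt) (auto simp: power2_eq_square intro: mult_mono)
  have err: "\<delta> * d\<^sup>2 / n * sqrt (a * b) \<le> \<delta> * d ^ 3 / n" if "0 \<le> a" "a \<le> d" "0 \<le> b" "b \<le> d" for a b :: real
    using mult_left_mono[OF sqrt_le_d[OF that], of "\<delta> * d\<^sup>2 / n"] \<delta> n
    by (simp add: power2_eq_square power3_eq_cube)
  define T where "T v x y = (of_bool (F v x) * (of_bool (F v (\<sigma> y)) * of_bool (E x y)) :: real)" for v x y
  define U where "U x v y = (of_bool (F x v) * (of_bool (E x y \<and> \<not> F x y) * of_bool (E v (\<sigma> y))) :: real)" for v x y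
  \<comment> \<open>In \<open>U\<close> the edge from \<open>v\<close> to \<open>\<sigma> y\<close>
    is relaxed from \<open>F\<close> to \<open>E\<close> so that mixing can count it. Both
    \<open>v\<close> and \<open>x\<close> range over \<open>Z\<close>, so the two sums can later be
    compared vertex by vertex.\<close>
  have TU: "(\<Sum>v\<in>Z. \<Sum>x\<in>Z. \<Sum>y\<in>W. T v x y) \<le> (\<Sum>x\<in>Z. \<Sum>v\<in>Z. \<Sum>y\<in>W. U x v y)"
  proof -
    have "(\<Sum>v\<in>Z. \<Sum>x\<in>Z. \<Sum>y\<in>W. T v x y) \<le> (\<Sum>v\<in>Z. \<Sum>x\<in>Z. \<Sum>y\<in>W. U x v y)"
    proof (intro sum_mono)
      fix v x y assume "v \<in> Z" "x \<in> Z" "y \<in> W"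
      then show "T v x y \<le> U x v y"
        using none symF[of v x] FE[of v "\<sigma> y"] unfolding T_def U_def by (auto split: split_of_bool)
    qed
    also have "\<dots> = (\<Sum>x\<in>Z. \<Sum>v\<in>Z. \<Sum>y\<in>W. U x v y)" by (rule sum.swap)
    finally show ?thesis .
  qed
  have lower: "d * z v * w v / n - \<delta> * d ^ 3 / n \<le> (\<Sum>x\<in>Z. \<Sum>y\<in>W. T v x y)" if v: "v \<in> Z" for v
  proof -
    have c: "card {y \<in> W. F v (\<sigma> y)} = card {u \<in> W. F v u}"
    proof (rule bij_betw_same_card)
      show "bij_betw \<sigma> {y \<in> W. F v (\<sigma> y)} {u \<in> W. F v u}"
        using \<sigma> unfolding bij_betw_def by (auto intro: inj_on_subset)
    qed
    have "edge_count E {x \<in> Z. F v x} {y \<in> W. F v (\<sigma> y)} = (\<Sum>x\<in>Z. \<Sum>y\<in>W. T v x y)"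
      unfolding T_def by (rule edge_count_filter[OF finZ])
    moreover have "\<bar>edge_count E {x \<in> Z. F v x} {y \<in> W. F v (\<sigma> y)} - d * z v * w v / n\<bar>
        \<le> \<delta> * d\<^sup>2 / n * sqrt (z v * w v)"
      using mixing[of "{x \<in> Z. F v x}" "{y \<in> W. F v (\<sigma> y)}"] Z(1) WV unfolding c z_def w_def by auto
    moreover have "\<delta> * d\<^sup>2 / n * sqrt (z v * w v) \<le> \<delta> * d ^ 3 / n"
      by (rule err) (use le_d[OF v] in \<open>auto simp: z_def w_def\<close>)
    ultimately show ?thesis by linarith
  qed
  have upper: "(\<Sum>v\<in>Z. \<Sum>y\<in>W. U x v y) \<le> d * z x * h x / n + \<delta> * d ^ 3 / n" if x: "x \<in> Z" for x
  proof -
    let ?N = "{y \<in> W. E x y \<and> \<not> F x y}"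
    have inj: "inj_on \<sigma> ?N" using \<sigma> unfolding bij_betw_def by (auto intro: inj_on_subset)
    have sub: "\<sigma> ` ?N \<subseteq> V" using \<sigma> WV unfolding bij_betw_def by auto
    have "(\<Sum>v\<in>Z. \<Sum>y\<in>W. U x v y) = edge_count (\<lambda>v y. E v (\<sigma> y)) {v \<in> Z. F x v} ?N"
      unfolding U_def by (rule edge_count_filter[OF finZ, symmetric])
    \<comment> \<open>Substituting \<open>\<sigma> y\<close> for \<open>y\<close> turns the twisted
      count into an ordinary one, without changing the size of the set.\<close>
    also have "\<dots> = edge_count E {v \<in> Z. F x v} (\<sigma> ` ?N)"
      unfolding edge_count_def by (simp add: sum.reindex[OF inj])
    finally have "(\<Sum>v\<in>Z. \<Sum>y\<in>W. U x v y) = edge_count E {v \<in> Z. F x v} (\<sigma> ` ?N)" .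
    moreover have "\<bar>edge_count E {v \<in> Z. F x v} (\<sigma> ` ?N) - d * z x * h x / n\<bar>
        \<le> \<delta> * d\<^sup>2 / n * sqrt (z x * h x)"
      using mixing[OF _ sub, of "{v \<in> Z. F x v}"] Z(1) unfolding card_image[OF inj] z_def h_def by auto
    moreover have "\<delta> * d\<^sup>2 / n * sqrt (z x * h x) \<le> \<delta> * d ^ 3 / n"
      by (rule err) (use le_d[OF x] in \<open>auto simp: z_def h_def\<close>)
    ultimately show ?thesis by linarith
  qed
  have "(\<Sum>v\<in>Z. d * z v * w v / n - \<delta> * d ^ 3 / n) \<le> (\<Sum>v\<in>Z. \<Sum>x\<in>Z. \<Sum>y\<in>W. T v x y)"
    by (intro sum_mono lower)
  also note TU
  also have "(\<Sum>x\<in>Z. \<Sum>v\<in>Z. \<Sum>y\<in>W. U x v y) \<le> (\<Sum>v\<in>Z. d * z v * h v / n + \<delta> * d ^ 3 / n)"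
    by (intro sum_mono upper)
  finally have contra: "(\<Sum>v\<in>Z. d * z v * w v / n - \<delta> * d ^ 3 / n) \<le> (\<Sum>v\<in>Z. d * z v * h v / n + \<delta> * d ^ 3 / n)" .
  \<comment> \<open>At each vertex the main terms differ by at least
    \<open>\<gamma> * \<eta> * d ^ 3 / n\<close>, which exceeds the two errors together.\<close>
  have "(\<Sum>v\<in>Z. d * z v * h v / n + \<delta> * d ^ 3 / n) < (\<Sum>v\<in>Z. d * z v * w v / n - \<delta> * d ^ 3 / n)"
  proof (rule sum_strict_mono[OF finZ(1) Z(2)])
    fix v assume v: "v \<in> Z"
    have "2 * \<delta> * d ^ 3 < \<gamma> * \<eta> * d ^ 3" using small d by simp
    also have "\<dots> = d * ((\<gamma> * d) * (\<eta> * d))" by (simp add: power3_eq_cube)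
    also have "\<dots> \<le> d * (z v * (w v - h v))"
    proof (intro mult_left_mono mult_mono)
      show "\<gamma> * d \<le> z v" using degZ[OF v] by (simp add: z_def)
      show "\<eta> * d \<le> w v - h v" using degW[OF v] by (simp add: w_def h_def)
    qed (use d \<eta> in \<open>auto simp: z_def\<close>)
    finally have "(d * z v * h v + \<delta> * d ^ 3) / n < (d * z v * w v - \<delta> * d ^ 3) / n"
      using n by (intro divide_strict_right_mono) (simp_all add: algebra_simps)
    then show "d * z v * h v / n + \<delta> * d ^ 3 / n < d * z v * w v / n - \<delta> * d ^ 3 / n"
      by (simp add: add_divide_distrib diff_divide_distrib)
  qed
  then show False using contra by simp
qed

section \<open>Cycles of all lengths under mixing\<close>

lemma successively_rotate:
  assumes "successively R C" "R (last C) (hd C)"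
  shows "successively R (rotate j C)"
proof -
  define k where "k = j mod length C"
  have "rotate j C = drop k C @ take k C" by (simp add: rotate_drop_take k_def)
  moreover have "successively R (take k C @ drop k C)" using assms(1) by simp
  then have "successively R (take k C)" "successively R (drop k C)"
    unfolding successively_append_iff by blast+
  moreover have "R (last (drop k C)) (hd (take k C))" if "drop k C \<noteq> []" "take k C \<noteq> []"
    using that assms(2) by (cases C) (auto simp: last_drop)
  ultimately show ?thesis by (simp only: successively_append_iff) blast
qed

text \<open>Take \<open>\<sigma>\<close> to be the shift by \<open>t - 3\<close> along the cycle on
  \<open>W\<close>. The segment from \<open>y\<close> to \<open>\<sigma> y\<close> has
  \<open>t - 2\<close> vertices, and \<open>v\<close>, \<open>x\<close> close it to length
  \<open>t\<close>; for \<open>t = 3\<close> the shift is the identity and the result is a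
  triangle.\<close>

lemma short_cycle_from_twisted_triangle:
  assumes C: "distinct C" "set C = W" "successively F C" "F (last C) (hd C)"
    and t: "3 \<le> t" "t - 2 \<le> length C"
    and ZW: "Z \<inter> W = {}" and irr: "\<And>v. \<not> F v v"
    and twisted: "\<And>\<sigma>. bij_betw \<sigma> W W \<Longrightarrow> \<exists>v\<in>Z. \<exists>x\<in>Z. \<exists>y\<in>W. F v x \<and> F x y \<and> F (\<sigma> y) v"
  shows "\<exists>L. length L = t \<and> distinct L \<and> set L \<subseteq> Z \<union> W \<and> successively F L \<and> F (last L) (hd L)"
proof -
  define m where "m = length C"
  define idx where "idx = inv_into {..<m} ((!) C)"
  define \<sigma> where "\<sigma> y = rotate (t - 3) C ! idx y" for y
  have bC: "bij_betw ((!) C) {..<m} W"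
    using bij_betw_nth[OF C(1), of "{..<m}" W] C(2) by (simp add: m_def lessThan_atLeast0)
  have bR: "bij_betw ((!) (rotate (t - 3) C)) {..<m} W"
    using bij_betw_nth[of "rotate (t - 3) C" "{..<m}" W] C by (simp add: m_def lessThan_atLeast0)
  have "bij_betw \<sigma> W W"
    using bij_betw_trans[OF bij_betw_inv_into[OF bC] bR] by (simp add: \<sigma>_def[abs_def] idx_def comp_def)
  then obtain v x y where vxy: "v \<in> Z" "x \<in> Z" "y \<in> W" "F v x" "F x y" "F (\<sigma> y) v"
    using twisted by blast
  define j where "j = idx y"
  have j: "j < m" "C ! j = y"
    using bij_betwE[OF bij_betw_inv_into[OF bC]] bij_betw_inv_into_right[OF bC vxy(3)] vxy(3)
    by (auto simp: j_def idx_def)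
  define P where "P = take (t - 2) (rotate j C)"
  have m: "m > 0" using j by simp
  have lenP: "length P = t - 2" using t by (simp add: P_def)
  then have ne: "P \<noteq> []" using t by auto
  have "hd P = rotate j C ! 0" using ne lenP by (simp add: hd_conv_nth P_def)
  also have "\<dots> = y" using j m by (simp add: nth_rotate m_def)
  finally have hdP: "hd P = y" .
  have "last P = rotate j C ! (t - 3)"
    using ne lenP t by (simp add: last_conv_nth P_def)
  also have "\<dots> = \<sigma> y"
    using j t m by (simp add: \<sigma>_def nth_rotate m_def flip: j_def) (simp add: add.commute)
  finally have lastP: "last P = \<sigma> y" .
  have setP: "set P \<subseteq> W" unfolding P_def using C(2) set_take_subset[of "t - 2" "rotate j C"] by simp
  have "successively F (take (t - 2) (rotate j C) @ drop (t - 2) (rotate j C))"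
    using successively_rotate[of F C j, OF C(3,4)] by simp
  then have sP: "successively F P" unfolding successively_append_iff P_def by blast
  let ?L = "x # P @ [v]"
  have "x \<noteq> v" using vxy(4) irr by blast
  then have "distinct ?L" using setP ZW vxy C(1) by (auto simp: P_def)
  moreover have "length ?L = t" using lenP t by simp
  moreover have "set ?L \<subseteq> Z \<union> W" using setP vxy by auto
  moreover have "successively F ?L"
    using sP ne hdP lastP vxy by (simp add: successively_append_iff successively_Cons)
  moreover have "F (last ?L) (hd ?L)" using vxy by simp
  ultimately show ?thesis by blast
qed

section \<open>A pseudorandom graph before and after the deletion\<close>

text \<open>\<open>E\<close> is adjacency in the given graph and \<open>F\<close> adjacency after
  the deletion; only \<open>E\<close> mixes. The error term is the spectral one with the eigenvalue
  bound replaced by \<open>\<epsilon>\<^sup>2 / 200 * d\<^sup>2 / n\<close>.\<close>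

locale pseudorandom_pair =
  fixes V :: "'a set" and E F :: "'a \<Rightarrow> 'a \<Rightarrow> bool" and d :: nat and \<epsilon> :: real
  assumes finV: "finite V" and symF: "\<And>u v. F u v \<Longrightarrow> F v u" and FE: "\<And>u v. F u v \<Longrightarrow> E u v"
    and irr: "\<And>v. \<not> F v v"
    and degE: "\<And>v. v \<in> V \<Longrightarrow> card {u \<in> V. E v u} = d"
    and degF: "\<And>v. v \<in> V \<Longrightarrow> (1/2 + \<epsilon>) * real d \<le> real (card {u \<in> V. F v u})"
    and mixing: "\<And>X Y. X \<subseteq> V \<Longrightarrow> Y \<subseteq> V \<Longrightarrow>
      \<bar>edge_count E X Y - real d * real (card X) * real (card Y) / real (card V)\<bar>
        \<le> \<epsilon>\<^sup>2 / 200 * (real d)\<^sup>2 / real (card V) * sqrt (real (card X) * real (card Y))"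
    and eps: "0 < \<epsilon>" "\<epsilon> \<le> 1/2" and large: "(400 / \<epsilon>) ^ 3 \<le> real (card V)" and d1: "1 \<le> d"
begin

definition n where "n = real (card V)"

lemma n_ge: "400 / \<epsilon> \<le> n" "8 \<le> n"
proof -
  have 1: "800 \<le> 400 / \<epsilon>" using eps by (simp add: field_simps)
  then have "400 / \<epsilon> \<le> (400 / \<epsilon>) ^ 3" by (intro self_le_power) auto
  then show "400 / \<epsilon> \<le> n" using large by (simp add: n_def)
  then show "8 \<le> n" using 1 by linarith
qed

lemma V_ne: "V \<noteq> {}"
  using n_ge by (auto simp: n_def)

lemma d_le_n: "real d \<le> n"
proof -
  obtain v where "v \<in> V" using V_ne by blast
  then have "d = card {u \<in> V. E v u}" by (simp add: degE)
  also have "\<dots> \<le> card V" by (rule card_mono[OF finV]) auto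
  finally show ?thesis by (simp add: n_def)
qed

text \<open>Mixing between a vertex and its own neighbourhood is what forces a large degree.\<close>

lemma degree_cubed_ge: "n\<^sup>2 \<le> real d ^ 3"
\<comment> \<open>If \<open>d\<close> is at least half of \<open>n\<close>, then
  \<open>8 \<le> n\<close> suffices. Otherwise the \<open>d\<close> edges from \<open>v\<close> to
  its neighbourhood exceed the expected number by at least \<open>d / 2\<close>, which the mixing
  error has to cover.\<close>
proof (cases "n \<le> 2 * real d")
  case True
  have "n\<^sup>2 * 8 \<le> n\<^sup>2 * n" by (rule mult_left_mono) (use n_ge in auto)
  also have "\<dots> = n ^ 3" by (simp add: power2_eq_square power3_eq_cube)
  also have "\<dots> \<le> (2 * real d) ^ 3" by (rule power_mono) (use True n_ge in auto)
  also have "\<dots> = 8 * real d ^ 3" by (simp add: power_mult_distrib)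
  finally show ?thesis by simp
next
  case False
  obtain v where v: "v \<in> V" using V_ne by blast
  have n0: "n > 0" using n_ge by linarith
  let ?N = "{u \<in> V. E v u}"
  have "edge_count E {v} ?N = real d"
    using finV by (simp add: edge_count_def degE[OF v, symmetric] Int_def conj_ac)
  moreover have "\<bar>edge_count E {v} ?N - real d * 1 * real d / n\<bar>
      \<le> \<epsilon>\<^sup>2 / 200 * (real d)\<^sup>2 / n * sqrt (1 * real d)"
    using mixing[of "{v}" ?N] v by (simp add: n_def degE)
  ultimately have "real d - real d * real d / n \<le> \<epsilon>\<^sup>2 / 200 * (real d)\<^sup>2 / n * sqrt (real d)"
    by (simp add: abs_le_iff)
  then have "(real d - real d * real d / n) * n \<le> \<epsilon>\<^sup>2 / 200 * (real d)\<^sup>2 / n * sqrt (real d) * n"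
    by (rule mult_right_mono) (use n0 in simp)
  then have "real d * (n - real d) \<le> \<epsilon>\<^sup>2 / 200 * (real d)\<^sup>2 * sqrt (real d)"
    using n0 by (simp add: algebra_simps)
  also have "\<dots> = real d * (\<epsilon>\<^sup>2 / 200 * (real d * sqrt (real d)))" by (simp add: power2_eq_square)
  finally have "n - real d \<le> \<epsilon>\<^sup>2 / 200 * (real d * sqrt (real d))" using d1 by simp
  also have "\<dots> \<le> 1/2 * (real d * sqrt (real d))"
  proof (rule mult_right_mono)
    have "\<epsilon>\<^sup>2 \<le> 1" using eps by (intro power_le_one) auto
    then show "\<epsilon>\<^sup>2 / 200 \<le> 1/2" by simp
  qed simp
  finally have "n \<le> real d * sqrt (real d)" using False by simp
  then have "n\<^sup>2 \<le> (real d * sqrt (real d))\<^sup>2" by (rule power_mono) (use n0 in simp)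
  also have "\<dots> = real d ^ 3" by (simp add: power_mult_distrib power2_eq_square power3_eq_cube)
  finally show ?thesis .
qed

lemma d_ge: "400 / \<epsilon> \<le> real d"
proof (rule ccontr)
  assume "\<not> ?thesis"
  then have "real d ^ 3 < (400 / \<epsilon>) ^ 3" by (intro power_strict_mono) auto
  also have "\<dots> \<le> n" using large by (simp add: n_def)
  also have "n \<le> n\<^sup>2" using n_ge by (intro self_le_power) auto
  finally show False using degree_cubed_ge by simp
qed

text \<open>The size condition for a random subset of density \<open>\<epsilon> / 6\<close>. With
  \<open>x\<close> the exponent, \<open>exp x\<close> is at least \<open>(x / 3) ^ 3\<close>; the
  cube is chosen since \<open>d ^ 3\<close> dominates \<open>n\<^sup>2\<close>, and one factor
  \<open>n\<close> absorbs the powers of \<open>\<epsilon>\<close>.\<close>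

lemma union_bound_small: "2 * n < exp (\<epsilon> / 6 * real d / 8)"
proof -
  define a where "a = 400 / \<epsilon>"
  have a: "a > 0" "\<epsilon> = 400 / a" using eps by (simp_all add: a_def)
  have n0: "n > 0" using n_ge by linarith
  define x where "x = \<epsilon> / 6 * real d / 8"
  have x: "x / 3 = (\<epsilon> / 144) * real d" by (simp add: x_def)
  have "2 * n < (400 / 144) ^ 3 * n" using n0 by (simp add: power3_eq_cube)
  also have "\<dots> \<le> (\<epsilon> / 144) ^ 3 * n\<^sup>2"
  proof -
    have "(400 / 144) ^ 3 * n = (\<epsilon> / 144) ^ 3 * (a ^ 3 * n)"
      using a by (simp add: power_divide)
    also have "\<dots> \<le> (\<epsilon> / 144) ^ 3 * (n * n)"
      by (intro mult_left_mono mult_right_mono) (use large eps n0 in \<open>auto simp: a_def n_def\<close>)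
    finally show ?thesis by (simp add: power2_eq_square)
  qed
  also have "\<dots> \<le> (\<epsilon> / 144) ^ 3 * real d ^ 3"
    by (intro mult_left_mono degree_cubed_ge) (use eps in auto)
  also have "\<dots> = (x / 3) ^ 3" unfolding x by (rule power_mult_distrib[symmetric])
  also have "\<dots> \<le> exp (x / 3) ^ 3"
  proof (rule power_mono)
    show "x / 3 \<le> exp (x / 3)" using exp_ge_add_one_self[of "x / 3"] by linarith
    show "0 \<le> x / 3" using eps by (simp add: x_def)
  qed
  also have "\<dots> = exp x" by (simp add: exp_of_nat_mult[symmetric])
  finally show ?thesis by (simp add: x_def)
qed

text \<open>The edges from \<open>S\<close> to its neighbourhood \<open>Y\<close> number at least
  \<open>(1/2 + \<epsilon>/2) * d\<close> per vertex of \<open>S\<close>. By mixing they number at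
  most \<open>d * y / n\<close> per vertex, up to an error of \<open>9/100 * \<epsilon> * d\<close>,
  so \<open>y / n\<close> exceeds one half.\<close>

lemma expansion:
  assumes W: "W \<subseteq> V" and degW: "\<And>v. v \<in> W \<Longrightarrow> (1/2 + \<epsilon>/2) * real d \<le> real (card {u \<in> W. F v u})"
    and S: "S \<subseteq> W" "\<epsilon> / 320 * real d \<le> real (card S)"
  shows "(1/2 + \<epsilon>/4) * n \<le> real (card {v \<in> W. \<exists>u\<in>S. F u v})"
proof -
  define Y where "Y = {v \<in> W. \<exists>u\<in>S. F u v}"
  define x y where "x = real (card S)" and "y = real (card Y)"
  have n0: "n > 0" and d0: "real d > 0" using n_ge d1 by linarith+
  have x0: "x > 0" using S(2) eps d0 unfolding x_def by (smt (verit) mult_pos_pos divide_pos_pos)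
  have Yn: "0 \<le> y" "y \<le> n" unfolding y_def n_def
    using card_mono[OF finV, of Y] W by (auto simp: Y_def)
  have fin: "finite W" "finite Y" using finite_subset[OF W finV] by (auto simp: Y_def)
  have "(1/2 + \<epsilon>/2) * real d * x = (\<Sum>u\<in>S. (1/2 + \<epsilon>/2) * real d)" by (simp add: x_def)
  also have "\<dots> \<le> edge_count E S Y"
    unfolding edge_count_def
  proof (rule sum_mono)
    fix u assume u: "u \<in> S"
    have "card {v \<in> W. F u v} \<le> card (Y \<inter> {v. E u v})"
      by (rule card_mono) (use fin FE u in \<open>auto simp: Y_def\<close>)
    then show "(1/2 + \<epsilon>/2) * real d \<le> (\<Sum>v\<in>Y. of_bool (E u v))"
      using degW[of u] u S(1) fin by (auto simp: Int_def)
  qed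
  also have "\<dots> \<le> real d * x * y / n + \<epsilon>\<^sup>2 / 200 * (real d)\<^sup>2 / n * sqrt (x * y)"
  proof -
    have "S \<subseteq> V" "Y \<subseteq> V" using S(1) W by (auto simp: Y_def)
    from mixing[OF this] show ?thesis unfolding x_def y_def n_def by linarith
  qed
  finally have main: "(1/2 + \<epsilon>/2) * real d * x \<le> real d * x * y / n + \<epsilon>\<^sup>2 / 200 * (real d)\<^sup>2 / n * sqrt (x * y)" .
  \<comment> \<open>Bounding \<open>y\<close> and \<open>d\<close> by \<open>n\<close> and
    \<open>d\<close> by \<open>320 / \<epsilon> * x\<close> leaves a square root of
    \<open>320 / \<epsilon>\<close>; 18 is chosen because its square 324 exceeds 320.\<close>
  have root: "real d / n * sqrt (x * y) \<le> 18 / \<epsilon> * x"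
  proof -
    have "(real d / n)\<^sup>2 * (x * y) \<le> (real d / n)\<^sup>2 * (x * n)"
      by (intro mult_left_mono) (use Yn x0 in auto)
    also have "\<dots> = (real d / n) * (real d * x)" using n0 by (simp add: power2_eq_square field_simps)
    also have "\<dots> \<le> 1 * (real d * x)"
      by (rule mult_right_mono) (use d_le_n n0 x0 in auto)
    also have "\<dots> \<le> (320 / \<epsilon> * x) * x"
      using mult_right_mono[of "real d" "320 / \<epsilon> * x" x] S(2) eps x0 by (simp add: x_def field_simps)
    also have "\<dots> \<le> (18 / \<epsilon> * x)\<^sup>2"
    proof -
      have "320 / \<epsilon> \<le> (18 / \<epsilon>)\<^sup>2" using eps by (simp add: power2_eq_square field_simps)
      from mult_right_mono[OF this, of "x * x"] show ?thesis
        by (simp add: power2_eq_square mult_ac)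
    qed
    finally have "sqrt ((real d / n)\<^sup>2 * (x * y)) \<le> 18 / \<epsilon> * x"
      by (intro real_le_lsqrt) (use eps x0 in auto)
    then show ?thesis using n0 by (simp add: real_sqrt_mult)
  qed
  have "\<epsilon>\<^sup>2 / 200 * (real d)\<^sup>2 / n * sqrt (x * y) = \<epsilon>\<^sup>2 / 200 * real d * (real d / n * sqrt (x * y))"
    by (simp add: power2_eq_square)
  also have "\<dots> \<le> \<epsilon>\<^sup>2 / 200 * real d * (18 / \<epsilon> * x)"
    by (rule mult_left_mono[OF root]) simp
  also have "\<dots> = (9/100 * \<epsilon>) * (real d * x)" using eps by (simp add: power2_eq_square)
  finally have "(1/2 + \<epsilon>/2) * (real d * x) \<le> (y / n + 9/100 * \<epsilon>) * (real d * x)"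
    using main by (simp add: algebra_simps)
  then have "1/2 + \<epsilon>/2 \<le> y / n + 9/100 * \<epsilon>"
    using d0 x0 by (subst (asm) mult_le_cancel_right_pos) auto
  then have "1/2 + \<epsilon>/4 \<le> y / n" using eps by linarith
  then show ?thesis using n0 by (simp add: y_def Y_def pos_le_divide_eq)
qed

lemma hamilton_cycle_on:
  assumes W: "W \<subseteq> V" "W \<noteq> {}"
    and degW: "\<And>v. v \<in> W \<Longrightarrow> (1/2 + \<epsilon>/2) * real d \<le> real (card {u \<in> W. F v u})"
  obtains C where "distinct C" "set C = W" "successively F C" "F (last C) (hd C)"
proof -
  \<comment> \<open>The block length balances two demands: \<open>6 * s + 1\<close> must stay below
    the expansion surplus \<open>\<epsilon> * n / 2\<close>, while at most
    \<open>33 / \<epsilon>\<close> blocks with \<open>2 * k\<close> pivots each must not exhaust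
    half the degree. The second one fixes \<open>k\<close> as a small multiple of
    \<open>\<epsilon> * d\<close>.\<close>
  define s where "s = nat \<lfloor>\<epsilon> * n / 16\<rfloor>"
  define k where "k = nat \<lceil>\<epsilon> / 320 * real d\<rceil>"
  define D where "D = nat \<lceil>real d / 2\<rceil>"
  have en: "400 \<le> \<epsilon> * n" using n_ge(1) eps by (simp add: field_simps)
  have ed: "400 \<le> \<epsilon> * real d" using d_ge eps by (simp add: field_simps)
  have s: "real s \<le> \<epsilon> * n / 16" "\<epsilon> * n / 32 \<le> real s" "1 \<le> s"
    unfolding s_def using en by linarith+
  have k: "\<epsilon> / 320 * real d \<le> real k" "real k \<le> \<epsilon> / 320 * real d + 1" "1 \<le> k"
    unfolding k_def using ed by linarith+
  have WV: "card W \<le> card V" by (rule card_mono[OF finV W(1)])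
  show thesis
  proof (rule hamilton_cycle_expanding[of W F D s k])
    show "finite W" by (rule finite_subset[OF W(1) finV])
    show "F u v \<Longrightarrow> F v u" for u v by (rule symF)
    show "\<not> F v v" for v by (rule irr)
    show "D \<le> card {u \<in> W. F v u}" if "v \<in> W" for v
    proof -
      have "real d / 2 \<le> (1/2 + \<epsilon>/2) * real d" using eps by (simp add: algebra_simps)
      then have "real d / 2 \<le> real (card {u \<in> W. F v u})" using degW[OF that] by linarith
      then show ?thesis unfolding D_def by linarith
    qed
    show "(card W div s + 1) * (2 * k) < D"
    proof -
      have "real (card W div s) \<le> real (card W) / real s" by (rule of_nat_div_le_of_nat)
      also have "\<dots> \<le> n / (\<epsilon> * n / 32)"
        using WV s(2) en by (intro frac_le) (auto simp: n_def)
      also have "\<dots> = 32 / \<epsilon>" using en eps by auto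
      finally have "real (card W div s) + 1 \<le> 33 / \<epsilon>" using eps by (simp add: field_simps)
      then have "(real (card W div s) + 1) * (2 * real k) \<le> 33 / \<epsilon> * (2 * (\<epsilon> / 320 * real d + 1))"
        by (rule mult_mono) (use k(2) eps in auto)
      also have "\<dots> = 66/320 * real d + 66 / \<epsilon>" using eps by (simp add: field_simps)
      also have "\<dots> < real d / 2" using d_ge eps by (simp add: field_simps)
      also have "\<dots> \<le> real D" unfolding D_def by linarith
      finally have "real ((card W div s + 1) * (2 * k)) < real D" by (simp add: algebra_simps)
      then show ?thesis by linarith
    qed
    show "card W + (6 * s + 1) < 2 * card {v \<in> W. \<exists>u\<in>S. F u v}" if S: "S \<subseteq> W" "k \<le> card S" for S
    proof -
      have "\<epsilon> / 320 * real d \<le> real (card S)" using k(1) S(2) by linarith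
      from expansion[OF W(1) degW S(1) this]
      have "n + \<epsilon> * n / 2 \<le> 2 * real (card {v \<in> W. \<exists>u\<in>S. F u v})" by (simp add: algebra_simps)
      moreover have "real (card W) \<le> n" using WV by (simp add: n_def)
      ultimately show ?thesis using s(1) en by linarith
    qed
  qed (use s k W that in auto)
qed

text \<open>Lengths from \<open>card V - card Z\<close> on come from deleting part of
  \<open>Z\<close> and taking a Hamilton cycle of the rest. Shorter ones come from a segment of a
  Hamilton cycle on \<open>V - Z\<close>, closed through two vertices of \<open>Z\<close>.\<close>

lemma all_cycle_lengths:
  assumes t: "3 \<le> t" "t \<le> card V"
  shows "\<exists>L. length L = t \<and> distinct L \<and> set L \<subseteq> V \<and> successively F L \<and> F (last L) (hd L)"
proof -
  have n0: "n > 0" and d0: "real d > 0" using n_ge d1 by linarith+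
  obtain Z where Z: "Z \<subseteq> V"
    and upZ: "\<And>v. v \<in> V \<Longrightarrow> real (card ({u \<in> V. E v u} \<inter> Z)) < 3 * (\<epsilon>/6) * real d"
    and loZ: "\<And>v. v \<in> V \<Longrightarrow> \<epsilon>/6 * real d / 8 < real (card ({u \<in> V. F v u} \<inter> Z))"
  \<comment> \<open>Density \<open>\<epsilon> / 6\<close> costs a vertex less than
    \<open>\<epsilon> * d / 2\<close> of its neighbours, so half of the surplus
    \<open>\<epsilon> * d\<close> survives the removal of any part of \<open>Z\<close>.\<close>
  proof (rule exists_balanced_subset[of V "\<epsilon>/6" "\<lambda>v. {u \<in> V. E v u}" "real d" "\<lambda>v. {u \<in> V. F v u}"])
    show "{u \<in> V. F v u} \<subseteq> V \<and> real d / 2 \<le> real (card {u \<in> V. F v u})" if "v \<in> V" for v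
    proof
      have "real d / 2 \<le> (1/2 + \<epsilon>) * real d" using eps by (simp add: algebra_simps)
      then show "real d / 2 \<le> real (card {u \<in> V. F v u})" using degF[OF that] by linarith
    qed auto
    show "2 * real (card V) < exp (\<epsilon>/6 * real d / 8)" using union_bound_small by (simp add: n_def)
  qed (use finV eps degE in auto)
  have fZ: "finite Z" by (rule finite_subset[OF Z finV])
  have degR: "(1/2 + \<epsilon>/2) * real d \<le> real (card {u \<in> V - R. F v u})" if R: "R \<subseteq> Z" and v: "v \<in> V" for R v
  proof -
    have "{u \<in> V. F v u} \<subseteq> {u \<in> V - R. F v u} \<union> ({u \<in> V. E v u} \<inter> Z)" using FE R by blast
    then have "card {u \<in> V. F v u} \<le> card ({u \<in> V - R. F v u} \<union> ({u \<in> V. E v u} \<inter> Z))"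
      by (rule card_mono[rotated]) (use finV fZ in auto)
    also have "\<dots> \<le> card {u \<in> V - R. F v u} + card ({u \<in> V. E v u} \<inter> Z)" by (rule card_Un_le)
    finally have "real (card {u \<in> V. F v u}) \<le> real (card {u \<in> V - R. F v u}) + real (card ({u \<in> V. E v u} \<inter> Z))"
      by linarith
    then show ?thesis using degF[OF v] upZ[OF v] by (simp add: algebra_simps)
  qed
  have neR: "V - R \<noteq> {}" if R: "R \<subseteq> Z" for R
  proof
    obtain v where v: "v \<in> V" using V_ne by blast
    assume "V - R = {}"
    then have "{u \<in> V - R. F v u} = {}" by blast
    then have "(1/2 + \<epsilon>/2) * real d \<le> 0" using degR[OF R v] by (simp only: card.empty of_nat_0)
    moreover have "(1/2 + \<epsilon>/2) * real d > 0" using eps d0 by simp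
    ultimately show False by linarith
  qed
  have ham: "\<exists>C. distinct C \<and> set C = V - R \<and> successively F C \<and> F (last C) (hd C)" if R: "R \<subseteq> Z" for R
  proof (rule hamilton_cycle_on[of "V - R"])
    show "(1/2 + \<epsilon>/2) * real d \<le> real (card {u \<in> V - R. F v u})" if "v \<in> V - R" for v
      using degR[OF R, of v] that by blast
  qed (use neR[OF R] in auto)
  have cZ: "card (V - Z) = card V - card Z" by (rule card_Diff_subset[OF fZ Z])
  show ?thesis
  proof (cases "card V - card Z \<le> t")
    case True
    then have "card V - t \<le> card Z" by linarith
    then obtain R where R: "R \<subseteq> Z" "card R = card V - t" using obtain_subset_with_card_n by metis
    obtain C where C: "distinct C" "set C = V - R" "successively F C" "F (last C) (hd C)"
      using ham[OF R(1)] by blast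
    have "card (V - R) = card V - card R"
      by (rule card_Diff_subset) (use R Z fZ finite_subset in auto)
    then have "length C = t" using C(1,2) R(2) t distinct_card[OF C(1)] by simp
    then show ?thesis using C by blast
  next
    case False
    obtain C where C: "distinct C" "set C = V - Z" "successively F C" "F (last C) (hd C)"
      using ham[of Z] by blast
    have lenC: "length C = card V - card Z" using distinct_card[OF C(1)] C(2) cZ by simp
    have "Z \<noteq> {}"
    proof
      assume "Z = {}"
      moreover obtain v where "v \<in> V" using V_ne by blast
      moreover have "0 < \<epsilon>/6 * real d / 8" using eps d0 by simp
      ultimately show False using loZ[of v] by simp
    qed
    have "\<exists>L. length L = t \<and> distinct L \<and> set L \<subseteq> Z \<union> (V - Z) \<and> successively F L \<and> F (last L) (hd L)"
    proof (rule short_cycle_from_twisted_triangle[OF C])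
      fix \<sigma> assume \<sigma>: "bij_betw \<sigma> (V - Z) (V - Z)"
      obtain v x y where "v \<in> Z" "x \<in> Z" "y \<in> V - Z" "F v x" "F x y" "F (\<sigma> y) v"
      proof (rule twisted_triangle[of V Z "V - Z" \<sigma> F E n d "\<epsilon>\<^sup>2/200" "\<epsilon>/48" \<epsilon>])
        show "F u v \<Longrightarrow> F v u" for u v by (rule symF)
        show "F u v \<Longrightarrow> E u v" for u v by (rule FE)
        show "\<bar>edge_count E X Y - real d * real (card X) * real (card Y) / n\<bar>
            \<le> \<epsilon>\<^sup>2 / 200 * (real d)\<^sup>2 / n * sqrt (real (card X) * real (card Y))"
          if "X \<subseteq> V" "Y \<subseteq> V" for X Y using mixing[OF that] by (simp add: n_def)
        show "\<epsilon> / 48 * real d \<le> real (card {u \<in> Z. F v u})" if "v \<in> Z" for v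
        proof -
          have "{u \<in> V. F v u} \<inter> Z = {u \<in> Z. F v u}" using Z by blast
          then show ?thesis using loZ[of v] that Z by auto
        qed
        \<comment> \<open>At most \<open>(1/2 - \<epsilon>) * d\<close> edges at \<open>v\<close>
          are deleted, and at least \<open>(1/2 + \<epsilon>/2) * d\<close> of the remaining ones
          lead to \<open>V - Z\<close>; the gap is \<open>3/2 * \<epsilon> * d\<close>.\<close>
        show "real (card {u \<in> V - Z. E v u \<and> \<not> F v u}) + \<epsilon> * real d \<le> real (card {u \<in> V - Z. F v u})"
          if "v \<in> Z" for v
        proof -
          have v: "v \<in> V" using that Z by blast
          have "card {u \<in> V. F v u} + card {u \<in> V - Z. E v u \<and> \<not> F v u}
              = card ({u \<in> V. F v u} \<union> {u \<in> V - Z. E v u \<and> \<not> F v u})"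
            by (rule card_Un_disjoint[symmetric]) (use finV in auto)
          also have "\<dots> \<le> card {u \<in> V. E v u}" by (rule card_mono) (use finV FE in auto)
          finally have "real (card {u \<in> V. F v u}) + real (card {u \<in> V - Z. E v u \<and> \<not> F v u}) \<le> real d"
            using degE[OF v] by linarith
          then have "real (card {u \<in> V - Z. E v u \<and> \<not> F v u}) \<le> (1/2 - \<epsilon>) * real d"
            using degF[OF v] by (simp add: algebra_simps)
          moreover have "0 \<le> \<epsilon> * real d" using eps by simp
          ultimately show ?thesis using degR[OF subset_refl v] by (simp add: algebra_simps)
        qed
        show "2 * (\<epsilon>\<^sup>2 / 200) < \<epsilon> / 48 * \<epsilon>" using eps by (simp add: power2_eq_square)
      qed (use finV Z \<open>Z \<noteq> {}\<close> \<sigma> n0 d0 degE eps in auto)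
      then show "\<exists>v\<in>Z. \<exists>x\<in>Z. \<exists>y\<in>V - Z. F v x \<and> F x y \<and> F (\<sigma> y) v" by blast
    qed (use t False lenC irr in auto)
    then show ?thesis using Z by (simp add: Un_absorb1)
  qed
qed

end

section \<open>Graphs\<close>

lemma edge_imp:
  assumes "simple_graph G" "{u, v} \<in> edges G"
  shows "u \<in> verts G" "v \<in> verts G" "u \<noteq> v"
  using assms by (auto simp: simple_graph_def)

lemma finite_edges:
  assumes "simple_graph G"
  shows "finite (edges G)"
proof (rule finite_subset)
  show "edges G \<subseteq> Pow (verts G)" using assms unfolding simple_graph_def by blast
  show "finite (Pow (verts G))" using assms unfolding simple_graph_def by simp
qed

lemma bij_betw_incident_edges:
  assumes "simple_graph G"
  shows "bij_betw (\<lambda>u. {v, u}) {u \<in> verts G. {v, u} \<in> edges G} {e \<in> edges G. v \<in> e}"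
proof (rule bij_betw_imageI)
  show "inj_on (\<lambda>u. {v, u}) {u \<in> verts G. {v, u} \<in> edges G}"
    by (auto simp: inj_on_def doubleton_eq_iff)
  show "(\<lambda>u. {v, u}) ` {u \<in> verts G. {v, u} \<in> edges G} = {e \<in> edges G. v \<in> e}"
  proof (intro equalityI subsetI)
    fix e assume "e \<in> {e \<in> edges G. v \<in> e}"
    then have e: "e \<in> edges G" "v \<in> e" by auto
    then have "card e = 2" "e \<subseteq> verts G" using assms by (auto simp: simple_graph_def)
    then obtain u where "e = {v, u}" "u \<in> verts G"
      using e(2) unfolding card_2_iff by blast
    then show "e \<in> (\<lambda>u. {v, u}) ` {u \<in> verts G. {v, u} \<in> edges G}" using e(1) by blast
  qed auto
qed

lemma vdegree_eq_card_neighbours: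
  "simple_graph G \<Longrightarrow> vdegree G v = card {u \<in> verts G. {v, u} \<in> edges G}"
  unfolding vdegree_def by (rule bij_betw_same_card[OF bij_betw_incident_edges, symmetric])

lemma vdegree_le_max_degree:
  assumes "finite (verts G)" "v \<in> verts G"
  shows "vdegree G v \<le> max_degree G"
  unfolding max_degree_def using assms by (intro cSUP_upper) auto

section \<open>Edge distribution from the spectrum\<close>

text \<open>The spectral bound is evaluated at the indicator vectors of \<open>X\<close> and
  \<open>Y\<close>, whose squared norms are the cardinalities. Subtracting \<open>d / n\<close> from
  the adjacency entries produces the expected number of edges.\<close>

lemma expander_mixing:
  assumes G: "ndl_graph n d lam G" and n: "n > 0" and lam: "lam \<ge> 0"
    and XY: "X \<subseteq> verts G" "Y \<subseteq> verts G"
  shows "\<bar>edge_count (\<lambda>u v. {u, v} \<in> edges G) X Y - real d * real (card X) * real (card Y) / real n\<bar>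
    \<le> lam * sqrt (real (card X) * real (card Y))"
proof -
  obtain vs where vs: "distinct vs" "set vs = verts G"
    and eig: "\<forall>\<mu> \<in># proots (char_poly (adjacency_matrix G vs)) - {#real d#}. \<bar>\<mu>\<bar> \<le> lam"
    using G unfolding ndl_graph_def by blast
  have sg: "simple_graph G" and cn: "card (verts G) = n" and reg: "regular d G"
    using G unfolding ndl_graph_def by blast+
  have len: "length vs = n" using distinct_card[OF vs(1)] vs(2) cn by simp
  define A where "A = adjacency_matrix G vs"
  have A: "A \<in> carrier_mat n n" by (simp add: A_def adjacency_matrix_def len)
  have Aij: "A $$ (i, j) = of_bool ({vs ! i, vs ! j} \<in> edges G)" if "i < n" "j < n" for i j
    using that by (simp add: A_def adjacency_matrix_def len)
  have bij: "bij_betw ((!) vs) {..<n} (verts G)"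
    using bij_betw_nth[OF vs(1), of "{..<n}" "verts G"] vs(2) len by (simp add: lessThan_atLeast0)
  have reindex: "(\<Sum>i<n. f (vs ! i)) = (\<Sum>v\<in>verts G. f v)" for f :: "'a \<Rightarrow> real"
    by (rule sum.reindex_bij_betw[OF bij])
  have finV: "finite (verts G)" using sg by (simp add: simple_graph_def)
  have row: "(\<Sum>j<n. A $$ (i, j)) = real d" if i: "i < n" for i
  proof -
    have v: "vs ! i \<in> verts G" using i len vs(2) nth_mem by blast
    have "(\<Sum>j<n. A $$ (i, j)) = (\<Sum>j<n. of_bool ({vs ! i, vs ! j} \<in> edges G))"
      by (intro sum.cong) (auto simp: Aij i)
    also have "\<dots> = (\<Sum>u\<in>verts G. of_bool ({vs ! i, u} \<in> edges G))" by (rule reindex)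
    also have "\<dots> = real (vdegree G (vs ! i))"
      unfolding vdegree_eq_card_neighbours[OF sg] using finV by (simp add: Int_def)
    also have "\<dots> = real d" using reg v by (simp add: regular_def)
    finally show ?thesis .
  qed
  define x where "x i = (of_bool (vs ! i \<in> X) :: real)" for i
  define y where "y i = (of_bool (vs ! i \<in> Y) :: real)" for i
  have size: "(\<Sum>i<n. of_bool (vs ! i \<in> S)) = real (card S)" if "S \<subseteq> verts G" for S
  proof -
    have "verts G \<inter> S = S" using that by blast
    then show ?thesis using reindex[of "\<lambda>v. of_bool (v \<in> S)"] finV by simp
  qed
  have sx: "(\<Sum>i<n. x i) = real (card X)" and sy: "(\<Sum>i<n. y i) = real (card Y)"
    using size XY unfolding x_def y_def by blast+
  have sq: "(\<Sum>i<n. (x i)\<^sup>2) = real (card X)" "(\<Sum>i<n. (y i)\<^sup>2) = real (card Y)"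
    unfolding sx[symmetric] sy[symmetric] by (intro sum.cong; simp add: x_def y_def)+
  have X: "X = {v \<in> verts G. v \<in> X}" and Y: "Y = {v \<in> verts G. v \<in> Y}" using XY by auto
  have "edge_count (\<lambda>u v. {u, v} \<in> edges G) X Y
      = (\<Sum>u\<in>verts G. \<Sum>v\<in>verts G. of_bool (u \<in> X) * (of_bool (v \<in> Y) * of_bool ({u, v} \<in> edges G)))"
    by (subst X, subst Y, rule edge_count_filter[OF finV finV])
  also have "\<dots> = (\<Sum>i<n. \<Sum>j<n. x i * (y j * A $$ (i, j)))"
    unfolding reindex[symmetric] by (intro sum.cong refl) (simp add: x_def y_def Aij)
  finally have count: "edge_count (\<lambda>u v. {u, v} \<in> edges G) X Y = (\<Sum>i<n. \<Sum>j<n. x i * (y j * A $$ (i, j)))" .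
  have "real d * real (card X) * real (card Y) / real n = (\<Sum>i<n. \<Sum>j<n. x i * y j) * (real d / n)"
    unfolding sum_product[symmetric] sx sy by simp
  also have "\<dots> = (\<Sum>i<n. \<Sum>j<n. x i * (real d / n) * y j)"
    unfolding sum_distrib_right by (intro sum.cong refl) simp
  finally have main: "real d * real (card X) * real (card Y) / real n = (\<Sum>i<n. \<Sum>j<n. x i * (real d / n) * y j)" .
  have "edge_count (\<lambda>u v. {u, v} \<in> edges G) X Y - real d * real (card X) * real (card Y) / real n
      = (\<Sum>i<n. \<Sum>j<n. x i * (A $$ (i, j) - real d / n) * y j)"
    unfolding count main sum_subtractf[symmetric] by (intro sum.cong refl) (simp add: algebra_simps)
  moreover have "(\<Sum>i<n. \<Sum>j<n. x i * (A $$ (i, j) - real d / n) * y j)\<^sup>2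
      \<le> lam\<^sup>2 * (\<Sum>i<n. (x i)\<^sup>2) * (\<Sum>i<n. (y i)\<^sup>2)"
    by (rule regular_symmetric_bilinear_bound[OF A n _ row])
      (use eig in \<open>auto simp: Aij insert_commute A_def[symmetric]\<close>)
  ultimately have "(edge_count (\<lambda>u v. {u, v} \<in> edges G) X Y - real d * real (card X) * real (card Y) / real n)\<^sup>2
      \<le> (lam * sqrt (real (card X) * real (card Y)))\<^sup>2"
    unfolding sq by (simp add: power_mult_distrib)
  then have "\<bar>edge_count (\<lambda>u v. {u, v} \<in> edges G) X Y - real d * real (card X) * real (card Y) / real n\<bar>
      \<le> \<bar>lam * sqrt (real (card X) * real (card Y))\<bar>"
    by (rule abs_le_square_iff[THEN iffD2])
  then show ?thesis using lam by simp
qed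

section \<open>Destroying all triangles by a maximum cut\<close>

text \<open>\<open>A\<close> is a cut with the fewest edges inside its two sides. Moving
  \<open>v\<close> across exchanges inside and crossing edges at \<open>v\<close> and changes
  nothing else, so by minimality the inside ones are at most half.\<close>

lemma exists_half_degree_bipartizing_subgraph:
  assumes sg: "simple_graph G"
  obtains A where "\<And>v. v \<in> verts G \<Longrightarrow>
    2 * vdegree \<lparr>verts = verts G, edges = {e \<in> edges G. e \<subseteq> A \<or> e \<inter> A = {}}\<rparr> v \<le> vdegree G v"
proof -
  define I where "I A = {e \<in> edges G. e \<subseteq> A \<or> e \<inter> A = {}}" for A
  have fin: "finite (edges G)" using finite_edges[OF sg] .
  obtain A where A: "\<And>B. card (I A) \<le> card (I B)"
    using ex_has_least_nat[of "\<lambda>_. True" undefined "\<lambda>A. card (I A)"] by auto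
  show thesis
  proof (rule that)
    fix v assume v: "v \<in> verts G"
    define B where "B = (if v \<in> A then A - {v} else insert v A)"
    have toggle: "e \<in> I B \<longleftrightarrow> (if v \<in> e then e \<notin> I A else e \<in> I A)" if e: "e \<in> edges G" for e
    proof -
      obtain a b where ab: "e = {a, b}" "a \<noteq> b"
        using e sg by (auto simp: simple_graph_def card_2_iff)
      then show ?thesis using e by (auto simp: I_def B_def)
    qed
    let ?in = "{e \<in> I A. v \<in> e}" and ?out = "{e \<in> edges G. v \<in> e \<and> e \<notin> I A}"
    have finI: "finite (I A)" using fin by (simp add: I_def)
    have IB: "I B = (I A - ?in) \<union> ?out"
    proof (rule Set.set_eqI)
      fix e
      have "I A \<subseteq> edges G" "I B \<subseteq> edges G" by (auto simp: I_def)
      then show "e \<in> I B \<longleftrightarrow> e \<in> (I A - ?in) \<union> ?out"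
        using toggle[of e] by (cases "e \<in> edges G"; cases "v \<in> e") auto
    qed
    have "card (I A) \<le> card (I B)" by (rule A)
    also have "\<dots> \<le> card (I A - ?in) + card ?out" unfolding IB by (rule card_Un_le)
    also have "card (I A - ?in) = card (I A) - card ?in" by (rule card_Diff_subset) (use finI in auto)
    finally have "card ?in \<le> card ?out" using card_mono[OF finI, of ?in] by auto
    moreover have "card ?in + card ?out = card {e \<in> edges G. v \<in> e}"
    proof -
      have "{e \<in> edges G. v \<in> e} = ?in \<union> ?out" by (auto simp: I_def)
      moreover have "card (?in \<union> ?out) = card ?in + card ?out"
        by (rule card_Un_disjoint) (use fin finI in auto)
      ultimately show ?thesis by simp
    qed
    ultimately show "2 * vdegree \<lparr>verts = verts G, edges = {e \<in> edges G. e \<subseteq> A \<or> e \<inter> A = {}}\<rparr> v \<le> vdegree G v"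
      by (simp add: vdegree_def I_def[symmetric])
  qed
qed

text \<open>Two of the three vertices of a triangle lie on the same side of \<open>A\<close>, so
  length 3 already fails.\<close>

lemma bipartite_not_pancyclic:
  assumes "3 \<le> card (verts G)" and bip: "\<And>e. e \<in> edges G \<Longrightarrow> \<not> (e \<subseteq> A \<or> e \<inter> A = {})"
  shows "\<not> pancyclic G"
proof
  assume "pancyclic G"
  then obtain vs where vs: "is_cycle G vs" "length vs = 3" using assms(1) by (auto simp: pancyclic_def)
  then have e: "{vs ! i, vs ! ((i + 1) mod 3)} \<in> edges G" if "i < 3" for i
    using that by (simp add: is_cycle_def)
  have "{vs ! 0, vs ! 1} \<in> edges G" "{vs ! 1, vs ! 2} \<in> edges G" "{vs ! 2, vs ! 0} \<in> edges G"
    using e[of 0] e[of 1] e[of 2] by (simp_all add: numeral_2_eq_2)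
  from this[THEN bip] show False by auto
qed

section \<open>Both directions of the resilience statement\<close>

lemma is_cycleI:
  assumes "3 \<le> length L" "distinct L" "set L \<subseteq> verts G"
    and s: "successively (\<lambda>u v. {u, v} \<in> edges G) L" and l: "{last L, hd L} \<in> edges G"
  shows "is_cycle G L"
  unfolding is_cycle_def
proof (intro conjI allI impI)
  fix i assume i: "i < length L"
  show "{L ! i, L ! ((i + 1) mod length L)} \<in> edges G"
  proof (cases "Suc i = length L")
    case True
    then have len: "length L = Suc i" by simp
    moreover from this have "L \<noteq> []" by auto
    ultimately have "last L = L ! i" "hd L = L ! ((i + 1) mod length L)"
      by (simp_all add: last_conv_nth hd_conv_nth)
    then show ?thesis using l by simp
  next
    case False
    then show ?thesis using successively_nth[OF s, of i] i by simp
  qed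
qed (use assms in auto)

text \<open>The ratio condition says that \<open>lam\<close> is at most
  \<open>\<epsilon>\<^sup>2 / 200 * d\<^sup>2 / n\<close>, which turns the mixing lemma into the
  form required by \<open>pseudorandom_pair\<close>.\<close>

lemma pancyclic_after_deletion:
  assumes G: "ndl_graph n d lam G" and lam: "0 < lam"
    and eps: "0 < \<epsilon>" "\<epsilon> \<le> 1/2" and large: "(400 / \<epsilon>) ^ 3 \<le> real n"
    and ratio: "200 / \<epsilon>\<^sup>2 \<le> (real d)\<^sup>2 / (real n * lam)"
    and H: "subgraph H G" "real (max_degree H) \<le> (1/2 - \<epsilon>) * real d"
  shows "pancyclic (delete_edges G H)"
proof -
  have sg: "simple_graph G" and cn: "card (verts G) = n" and reg: "regular d G"
    using G unfolding ndl_graph_def by blast+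
  have finV: "finite (verts G)" using sg by (simp add: simple_graph_def)
  have "0 < (400 / \<epsilon>) ^ 3" using eps by simp
  then have n0: "0 < n" using large by (cases n) auto
  have "0 < 200 / \<epsilon>\<^sup>2" using eps by simp
  then have d0: "d \<noteq> 0" using ratio by (cases d) auto
  have lam_le: "lam \<le> \<epsilon>\<^sup>2 / 200 * (real d)\<^sup>2 / real n"
    using ratio n0 lam eps by (simp add: field_simps)
  define E where "E u v \<longleftrightarrow> {u, v} \<in> edges G" for u v
  define F where "F u v \<longleftrightarrow> {u, v} \<in> edges (delete_edges G H)" for u v
  have F: "F u v \<longleftrightarrow> {u, v} \<in> edges G \<and> {u, v} \<notin> edges H" for u v
    by (simp add: F_def delete_edges_def)
  have sH: "simple_graph H" "verts H \<subseteq> verts G" "edges H \<subseteq> edges G" using H by (auto simp: subgraph_def)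
  interpret pseudorandom_pair "verts G" E F d \<epsilon>
  proof
    show "F u v \<Longrightarrow> F v u" for u v by (simp add: F insert_commute)
    show "\<not> F v v" for v using edge_imp(3)[OF sg, of v v] by (auto simp: F)
    show degE: "card {u \<in> verts G. E v u} = d" if "v \<in> verts G" for v
      using reg that vdegree_eq_card_neighbours[OF sg, of v] by (simp add: E_def regular_def)
    show "(1/2 + \<epsilon>) * real d \<le> real (card {u \<in> verts G. F v u})" if v: "v \<in> verts G" for v
    proof -
      \<comment> \<open>The maximum degree of \<open>H\<close> ranges over the vertices of
        \<open>H\<close> only; a vertex of \<open>G\<close> outside \<open>H\<close> loses no
        edge.\<close>
      have degH: "real (card {u \<in> verts G. {v, u} \<in> edges H}) \<le> (1/2 - \<epsilon>) * real d"
      proof (cases "v \<in> verts H")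
        case True
        have "{u \<in> verts G. {v, u} \<in> edges H} = {u \<in> verts H. {v, u} \<in> edges H}"
          using edge_imp[OF sH(1)] sH(2) by blast
        then have "card {u \<in> verts G. {v, u} \<in> edges H} \<le> max_degree H"
          using vdegree_le_max_degree[OF _ True] sH(1) vdegree_eq_card_neighbours[OF sH(1)]
          by (simp add: simple_graph_def)
        then show ?thesis using H(2) by linarith
      next
        case False
        then have "{u \<in> verts G. {v, u} \<in> edges H} = {}" using edge_imp[OF sH(1)] by blast
        moreover have "0 \<le> (1/2 - \<epsilon>) * real d" using eps by simp
        ultimately show ?thesis by (simp only: card.empty of_nat_0)
      qed
      have "card {u \<in> verts G. E v u} \<le> card ({u \<in> verts G. F v u} \<union> {u \<in> verts G. {v, u} \<in> edges H})"
        by (rule card_mono) (use finV in \<open>auto simp: E_def F\<close>)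
      also have "\<dots> \<le> card {u \<in> verts G. F v u} + card {u \<in> verts G. {v, u} \<in> edges H}"
        by (rule card_Un_le)
      finally have "real d \<le> real (card {u \<in> verts G. F v u}) + real (card {u \<in> verts G. {v, u} \<in> edges H})"
        unfolding degE[OF v] by linarith
      then show ?thesis using degH by (simp add: algebra_simps)
    qed
    show "\<bar>edge_count E X Y - real d * real (card X) * real (card Y) / real (card (verts G))\<bar>
        \<le> \<epsilon>\<^sup>2 / 200 * (real d)\<^sup>2 / real (card (verts G)) * sqrt (real (card X) * real (card Y))"
      if "X \<subseteq> verts G" "Y \<subseteq> verts G" for X Y
    proof -
      have "\<bar>edge_count E X Y - real d * real (card X) * real (card Y) / real n\<bar>
          \<le> lam * sqrt (real (card X) * real (card Y))"
        using expander_mixing[OF G n0 _ that] lam by (simp add: E_def[abs_def])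
      also have "\<dots> \<le> \<epsilon>\<^sup>2 / 200 * (real d)\<^sup>2 / real n * sqrt (real (card X) * real (card Y))"
        by (rule mult_right_mono[OF lam_le]) simp
      finally show ?thesis by (simp only: cn)
    qed
  qed (use finV eps large d0 cn in \<open>auto simp: E_def F\<close>)
  show ?thesis unfolding pancyclic_def
  proof (intro allI impI)
    fix t assume t: "3 \<le> t \<and> t \<le> card (verts (delete_edges G H))"
    then obtain L where L: "length L = t" "distinct L" "set L \<subseteq> verts G" "successively F L" "F (last L) (hd L)"
      using all_cycle_lengths[of t] by (auto simp: delete_edges_def)
    have "is_cycle (delete_edges G H) L"
      by (rule is_cycleI) (use L t in \<open>auto simp: F_def[abs_def] delete_edges_def\<close>)
    then show "\<exists>vs. is_cycle (delete_edges G H) vs \<and> length vs = t" using L by blast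
  qed
qed

lemma not_pancyclic_after_deletion:
  assumes G: "ndl_graph n d lam G" and n: "3 \<le> n" and eps: "0 < \<epsilon>"
  shows "\<exists>H. subgraph H G \<and> real (max_degree H) \<le> (1/2 + \<epsilon>) * real d \<and> \<not> pancyclic (delete_edges G H)"
proof -
  have sg: "simple_graph G" and cn: "card (verts G) = n" and reg: "regular d G"
    using G unfolding ndl_graph_def by blast+
  obtain A where A: "\<And>v. v \<in> verts G \<Longrightarrow>
      2 * vdegree \<lparr>verts = verts G, edges = {e \<in> edges G. e \<subseteq> A \<or> e \<inter> A = {}}\<rparr> v \<le> vdegree G v"
    using exists_half_degree_bipartizing_subgraph[OF sg] by blast
  define H where "H = \<lparr>verts = verts G, edges = {e \<in> edges G. e \<subseteq> A \<or> e \<inter> A = {}}\<rparr>"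
  have "verts G \<noteq> {}" using n cn by auto
  moreover have "vdegree H v \<le> d div 2" if "v \<in> verts G" for v
    using A[OF that] reg that by (simp add: H_def regular_def)
  ultimately have "max_degree H \<le> d div 2"
    unfolding max_degree_def by (intro cSUP_least) (auto simp: H_def)
  then have "real (max_degree H) \<le> real d / 2" by linarith
  also have "\<dots> \<le> (1/2 + \<epsilon>) * real d" using eps by (simp add: algebra_simps)
  finally have "real (max_degree H) \<le> (1/2 + \<epsilon>) * real d" .
  moreover have "subgraph H G" using sg by (auto simp: subgraph_def simple_graph_def H_def)
  moreover have "\<not> pancyclic (delete_edges G H)"
    by (rule bipartite_not_pancyclic[of _ A]) (use n cn in \<open>auto simp: delete_edges_def H_def\<close>)
  ultimately show ?thesis by blast
qed

theorem theorem1p2: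
  fixes G :: "nat \<Rightarrow> 'a ugraph" and d :: "nat \<Rightarrow> nat" and lam :: "nat \<Rightarrow> real"
  assumes "\<And>n. ndl_graph n (d n) (lam n) (G n)"
    and "filterlim (\<lambda>n. (real (d n))\<^sup>2 / (real n * lam n)) at_top sequentially"
  shows "\<forall>\<epsilon>::real. \<epsilon> > 0 \<longrightarrow> (\<forall>\<^sub>F n in sequentially.
      (\<forall>H. subgraph H (G n) \<and> real (max_degree H) \<le> (1/2 - \<epsilon>) * real (d n)
            \<longrightarrow> pancyclic (delete_edges (G n) H)) \<and>
      (\<exists>H. subgraph H (G n) \<and> real (max_degree H) \<le> (1/2 + \<epsilon>) * real (d n)
            \<and> \<not> pancyclic (delete_edges (G n) H)))"
proof (intro allI impI)
  fix \<epsilon> :: real assume eps: "\<epsilon> > 0"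
  \<comment> \<open>Part (i) is proved for parameters up to 1/2. Lowering \<epsilon> to \<delta>
    only weakens the degree condition on \<open>H\<close>, so larger \<epsilon> are covered.\<close>
  define \<delta> where "\<delta> = min \<epsilon> (1/2)"
  have \<delta>: "0 < \<delta>" "\<delta> \<le> 1/2" "\<delta> \<le> \<epsilon>" using eps by (auto simp: \<delta>_def)
  have "\<forall>\<^sub>F n in sequentially. 200 / \<delta>\<^sup>2 \<le> (real (d n))\<^sup>2 / (real n * lam n)"
    using assms(2) by (simp add: filterlim_at_top)
  moreover have "\<forall>\<^sub>F n in sequentially. (400 / \<delta>) ^ 3 \<le> real n"
    using filterlim_real_sequentially by (simp add: filterlim_at_top)
  moreover have "\<forall>\<^sub>F n in sequentially. (3::nat) \<le> n" by (rule eventually_ge_at_top)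
  ultimately show "\<forall>\<^sub>F n in sequentially.
      (\<forall>H. subgraph H (G n) \<and> real (max_degree H) \<le> (1/2 - \<epsilon>) * real (d n)
            \<longrightarrow> pancyclic (delete_edges (G n) H)) \<and>
      (\<exists>H. subgraph H (G n) \<and> real (max_degree H) \<le> (1/2 + \<epsilon>) * real (d n)
            \<and> \<not> pancyclic (delete_edges (G n) H))"
  proof eventually_elim
    case (elim n)
    have "0 < 200 / \<delta>\<^sup>2" using \<delta> by simp
    then have "0 < (real (d n))\<^sup>2 / (real n * lam n)" using elim(1) by linarith
    \<comment> \<open>The sign of \<open>lam n\<close> is not assumed; it follows from the ratio
      being positive.\<close>
    then have lam: "0 < lam n" using elim(3) by (simp add: zero_less_divide_iff zero_less_mult_iff)
    show ?case
    proof (intro conjI allI impI)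
      fix H assume H: "subgraph H (G n) \<and> real (max_degree H) \<le> (1/2 - \<epsilon>) * real (d n)"
      have "(1/2 - \<epsilon>) * real (d n) \<le> (1/2 - \<delta>) * real (d n)"
        using \<delta> by (intro mult_right_mono) auto
      then have "real (max_degree H) \<le> (1/2 - \<delta>) * real (d n)" using H by linarith
      then show "pancyclic (delete_edges (G n) H)"
        using pancyclic_after_deletion[OF assms(1) lam \<delta>(1,2) elim(2,1)] H by blast
    qed (rule not_pancyclic_after_deletion[OF assms(1) elim(3) eps])
  qed
qed

end
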